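(* Let $k\ge3$, $g\ge1$ and $n\ge0$. Let $G$ be a group, and let $\rho_G:B_k(\widehat\Sigma_{g,n})\to G$ be a homomorphism. (i) The following conditions are equivalent: (a) $\rho_G$ factors through $\rho_k:B_k(\widehat\Sigma_{g,n})\to B_k(\widehat\Sigma_{g,n})/\Gamma_3(B_k(\widehat\Sigma_{g,n}))$; (b) the restriction of $\rho_G$ to $B_k(\mathbb D_n)$ (i.e. $\rho_G\circ\iota_k$) factors through $r_k:B_k(\mathbb D_n)\to B_k(\mathbb D_n)/\Gamma_2(B_k(\mathbb D_n))$; (c) there exists $\sigma\in G$ such that $\rho_G(S)=\{\sigma\}$. (ii) There exists an injective homomorphism $\alpha_k:B_k(\mathbb D_n)/\Gamma_2(B_k(\mathbb D_n))\to B_k(\widehat\Sigma_{g,n})/\Gamma_3(B_k(\widehat\Sigma_{g,n}))$ that satisfies $\alpha_k\circ r_k=\rho_k\circ\iota_k$ and whose image is the centre of $B_k(\widehat\Sigma_{g,n})/\Gamma_3(B_k(\widehat\Sigma_{g,n}))$. (iii) Let $\rho_{G,3}:B_k(\widehat\Sigma_{g,n})/\Gamma_3(B_k(\widehat\Sigma_{g,n}))\to G$ be a homomorphism, and let $\rho_{G,2}=\rho_{G,3}\circ\alpha_k:B_k(\mathbb D_n)/\Gamma_2(B_k(\mathbb D_n))\to G$. Then $\rho_{G,3}$ is injective if and only if $\rho_{G,2}$ is. (iv) Let $\rho_{G,2}:B_k(\mathbb D_n)/\Gamma_2(B_k(\mathbb D_n))\to G$ be a homomorphism such that $\rho_G\circ\iota_k=\rho_{G,2}\circ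 r_k$. Then there exists a homomorphism $\rho_{G,3}:B_k(\widehat\Sigma_{g,n})/\Gamma_3(B_k(\widehat\Sigma_{g,n}))\to G$ such that $\rho_{G,3}\circ\rho_k=\rho_G$ and $\rho_{G,2}=\rho_{G,3}\circ\alpha_k$. Furthermore, $\rho_{G,3}$ is injective if and only if $\rho_{G,2}$ is injective. In particular, if $\rho_{G,2}$ is injective and $\rho_G$ is surjective then $\rho_{G,3}$ is an isomorphism.
   Context: For a connected surface $\Sigma$, $B_k(\Sigma)=\pi_1(\mathbb F_k(\Sigma)/S_k)$, where $\mathbb F_k(\Sigma)=\{(x_1,\dots,x_k)\in\Sigma^k: x_i\neq x_j\ (i\ne j)\}$. $\widehat\Sigma_g$ is a compact connected orientable surface of genus $g$ with one boundary component, $\widehat\Sigma_{g,n}$ is $\widehat\Sigma_g$ minus $n$ interior points, and $\mathbb D_n$ is the disc minus $n$ interior points ($\mathbb D_0=\mathbb D^2$). $\Gamma_1(G)=G$, $\Gamma_i(G)=[G,\Gamma_{i-1}(G)]$. $\rho_k$ and $r_k$ are the canonical projections; $\iota_k:B_k(\mathbb D_n)\to B_k(\widehat\Sigma_{g,n})$ is the natural inclusion induced by embedding a disc containing the $n$ punctures. Known presentation of $B_k(\widehat\Sigma_{g,n})$: generators $S=\{\sigma_1,\dots,\sigma_{k-1}\}$, $AB=\{a_1,b_1,\dots,a_g,b_g\}$, $Z=\{\zeta_1,\dots,\zeta_n\}$ (empty if $n=0$); write $c<d$ for $c\in\{a_i,b_i\}$, $d\in\{a_j,b_j\}$, $i<j$.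 Relations: $\sigma_i\sigma_j=\sigma_j\sigma_i$ for $|i-j|\ge2$; $\sigma_i\sigma_{i+1}\sigma_i=\sigma_{i+1}\sigma_i\sigma_{i+1}$; $c\sigma_i=\sigma_ic$ for $i\neq1$, $c\in AB\cup Z$; $c\sigma_1c\sigma_1=\sigma_1c\sigma_1c$ for $c\in AB\cup Z$; $a_i\sigma_1b_i=\sigma_1b_i\sigma_1a_i\sigma_1$; $\sigma_1^{-1}c\sigma_1$ commutes with $d$ for $c,d\in AB$, $c<d$; $\sigma_1^{-1}\zeta_i\sigma_1$ commutes with every $c\in AB$, and with $\zeta_j$ for $i<j$. For $g=0$ (no $AB$) this is a presentation of $B_k(\mathbb D_n)$, and $\iota_k$ sends each generator to the generator of the same name. *)

theory Defs
  imports
    "HOL-Analysis.Analysis"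
    "HOL-Algebra.Coset"
    "HOL-Algebra.Generated_Groups"
    "HOL-Combinatorics.Permutations"
begin

section \<open>Lower central series and centre\<close>

definition commutator_subgroup :: "('a, 'b) monoid_scheme \<Rightarrow> 'a set \<Rightarrow> 'a set \<Rightarrow> 'a set" where
  "commutator_subgroup G H K =
     generate G {h \<otimes>\<^bsub>G\<^esub> k \<otimes>\<^bsub>G\<^esub> inv\<^bsub>G\<^esub> h \<otimes>\<^bsub>G\<^esub> inv\<^bsub>G\<^esub> k | h k. h \<in> H \<and> k \<in> K}"

text \<open>The series is numbered from \<open>1\<close>; the value at \<open>0\<close> is a dummy.\<close>

fun lower_central :: "('a, 'b) monoid_scheme \<Rightarrow> nat \<Rightarrow> 'a set" where
  "lower_central G 0 = carrier G"
| "lower_central G (Suc 0) = carrier G"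
| "lower_central G (Suc (Suc i)) = commutator_subgroup G (carrier G) (lower_central G (Suc i))"

definition centre :: "('a, 'b) monoid_scheme \<Rightarrow> 'a set" where
  "centre G = {z \<in> carrier G. \<forall>x\<in>carrier G. z \<otimes>\<^bsub>G\<^esub> x = x \<otimes>\<^bsub>G\<^esub> z}"

definition factors_through_quotient ::
  "('a, 'b) monoid_scheme \<Rightarrow> 'a set \<Rightarrow> ('c, 'd) monoid_scheme \<Rightarrow> ('a \<Rightarrow> 'c) \<Rightarrow> bool" where
  "factors_through_quotient B N G f \<longleftrightarrow>
     (\<exists>h\<in>hom (B Mod N) G. \<forall>x\<in>carrier B. f x = h (N #>\<^bsub>B\<^esub> x))"


section \<open>Group presentations\<close>

datatype 'x letter = Pos 'x | Neg 'x

definition words :: "'x set \<Rightarrow> 'x letter list set" where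
  "words X = lists (Pos ` X \<union> Neg ` X)"

text \<open>The congruence on words over \<open>X\<close> generated by free cancellation and by the relations
  \<open>l = r\<close> for \<open>(l, r) \<in> R\<close>.\<close>

inductive_set word_equiv ::
    "'x set \<Rightarrow> ('x letter list \<times> 'x letter list) set \<Rightarrow> ('x letter list \<times> 'x letter list) set"
  for X R where
  refl: "w \<in> words X \<Longrightarrow> (w, w) \<in> word_equiv X R"
| sym: "(u, v) \<in> word_equiv X R \<Longrightarrow> (v, u) \<in> word_equiv X R"
| trans: "(u, v) \<in> word_equiv X R \<Longrightarrow> (v, w) \<in> word_equiv X R \<Longrightarrow> (u, w) \<in> word_equiv X R"
| cancel_pos_neg: "u \<in> words X \<Longrightarrow> v \<in> words X \<Longrightarrow> x \<in> X \<Longrightarrow>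
    (u @ [Pos x, Neg x] @ v, u @ v) \<in> word_equiv X R"
| cancel_neg_pos: "u \<in> words X \<Longrightarrow> v \<in> words X \<Longrightarrow> x \<in> X \<Longrightarrow>
    (u @ [Neg x, Pos x] @ v, u @ v) \<in> word_equiv X R"
| relation: "u \<in> words X \<Longrightarrow> v \<in> words X \<Longrightarrow> l \<in> words X \<Longrightarrow> r \<in> words X \<Longrightarrow> (l, r) \<in> R \<Longrightarrow>
    (u @ l @ v, u @ r @ v) \<in> word_equiv X R"

definition presented_group ::
    "'x set \<Rightarrow> ('x letter list \<times> 'x letter list) set \<Rightarrow> 'x letter list set monoid" where
  "presented_group X R =
    \<lparr>carrier = words X // word_equiv X R,
     mult = (\<lambda>U V. \<Union>u\<in>U. \<Union>v\<in>V. word_equiv X R `` {u @ v}),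
     one = word_equiv X R `` {[]}\<rparr>"

text \<open>The family \<open>gen\<close> of elements of \<open>B\<close> exhibits \<open>B\<close> as the group presented by \<open>X\<close> and \<open>R\<close>.\<close>

definition has_presentation ::
    "('b, 'm) monoid_scheme \<Rightarrow> ('x \<Rightarrow> 'b) \<Rightarrow> 'x set \<Rightarrow> ('x letter list \<times> 'x letter list) set \<Rightarrow> bool"
  where
  "has_presentation B gen X R \<longleftrightarrow>
     (\<exists>f\<in>iso (presented_group X R) B. \<forall>x\<in>X. f (word_equiv X R `` {[Pos x]}) = gen x)"


section \<open>The presentation of surface braid groups\<close>

text \<open>\<open>Sig i\<close>, \<open>Aa i\<close>, \<open>Bb i\<close>, \<open>Zeta i\<close> are formal names for \<open>\<sigma>\<^sub>i\<close>, \<open>a\<^sub>i\<close>, \<open>b\<^sub>i\<close>, \<open>\<zeta>\<^sub>i\<close>. The braid group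
  itself is defined topologically below; standard generators of it are any family of braids for which
  the map from the names to these braids satisfies \<^const>\<open>has_presentation\<close> with the following
  generators and relations.\<close>

datatype braid_gen = Sig nat | Aa nat | Bb nat | Zeta nat

definition S_gens :: "nat \<Rightarrow> braid_gen set" where
  "S_gens k = Sig ` {1..<k}"

definition AB_gens :: "nat \<Rightarrow> braid_gen set" where
  "AB_gens g = Aa ` {1..g} \<union> Bb ` {1..g}"

definition Z_gens :: "nat \<Rightarrow> braid_gen set" where
  "Z_gens n = Zeta ` {1..n}"

definition braid_gens :: "nat \<Rightarrow> nat \<Rightarrow> nat \<Rightarrow> braid_gen set" where
  "braid_gens k g n = S_gens k \<union> AB_gens g \<union> Z_gens n"

definition AB_less :: "nat \<Rightarrow> braid_gen \<Rightarrow> braid_gen \<Rightarrow> bool" where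
  "AB_less g c d \<longleftrightarrow>
     (\<exists>i j. 1 \<le> i \<and> i < j \<and> j \<le> g \<and> c \<in> {Aa i, Bb i} \<and> d \<in> {Aa j, Bb j})"

inductive_set braid_rels ::
    "nat \<Rightarrow> nat \<Rightarrow> nat \<Rightarrow> (braid_gen letter list \<times> braid_gen letter list) set"
  for k g n where
  far: "Sig i \<in> S_gens k \<Longrightarrow> Sig j \<in> S_gens k \<Longrightarrow> i + 2 \<le> j \<or> j + 2 \<le> i \<Longrightarrow>
    ([Pos (Sig i), Pos (Sig j)], [Pos (Sig j), Pos (Sig i)]) \<in> braid_rels k g n"
| braid: "Sig i \<in> S_gens k \<Longrightarrow> Sig (Suc i) \<in> S_gens k \<Longrightarrow>
    ([Pos (Sig i), Pos (Sig (Suc i)), Pos (Sig i)],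
     [Pos (Sig (Suc i)), Pos (Sig i), Pos (Sig (Suc i))]) \<in> braid_rels k g n"
| local: "c \<in> AB_gens g \<union> Z_gens n \<Longrightarrow> Sig i \<in> S_gens k \<Longrightarrow> i \<noteq> 1 \<Longrightarrow>
    ([Pos c, Pos (Sig i)], [Pos (Sig i), Pos c]) \<in> braid_rels k g n"
| square: "c \<in> AB_gens g \<union> Z_gens n \<Longrightarrow> Sig 1 \<in> S_gens k \<Longrightarrow>
    ([Pos c, Pos (Sig 1), Pos c, Pos (Sig 1)],
     [Pos (Sig 1), Pos c, Pos (Sig 1), Pos c]) \<in> braid_rels k g n"
| handle: "1 \<le> i \<Longrightarrow> i \<le> g \<Longrightarrow> Sig 1 \<in> S_gens k \<Longrightarrow>
    ([Pos (Aa i), Pos (Sig 1), Pos (Bb i)],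
     [Pos (Sig 1), Pos (Bb i), Pos (Sig 1), Pos (Aa i), Pos (Sig 1)]) \<in> braid_rels k g n"
| handles: "AB_less g c d \<Longrightarrow> Sig 1 \<in> S_gens k \<Longrightarrow>
    ([Neg (Sig 1), Pos c, Pos (Sig 1), Pos d],
     [Pos d, Neg (Sig 1), Pos c, Pos (Sig 1)]) \<in> braid_rels k g n"
| puncture_handle: "Zeta i \<in> Z_gens n \<Longrightarrow> c \<in> AB_gens g \<Longrightarrow> Sig 1 \<in> S_gens k \<Longrightarrow>
    ([Neg (Sig 1), Pos (Zeta i), Pos (Sig 1), Pos c],
     [Pos c, Neg (Sig 1), Pos (Zeta i), Pos (Sig 1)]) \<in> braid_rels k g n"
| punctures: "Zeta i \<in> Z_gens n \<Longrightarrow> Zeta j \<in> Z_gens n \<Longrightarrow> i < j \<Longrightarrow> Sig 1 \<in> S_gens k \<Longrightarrow>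
    ([Neg (Sig 1), Pos (Zeta i), Pos (Sig 1), Pos (Zeta j)],
     [Pos (Zeta j), Neg (Sig 1), Pos (Zeta i), Pos (Sig 1)]) \<in> braid_rels k g n"


section \<open>Quotient topology\<close>

definition quotient_topology :: "'a topology \<Rightarrow> ('a \<Rightarrow> 'b) \<Rightarrow> 'b topology" where
  "quotient_topology X q =
     topology (\<lambda>U. U \<subseteq> q ` topspace X \<and> openin X {x \<in> topspace X. q x \<in> U})"

lemma openin_quotient_topology:
  "openin (quotient_topology X q) U \<longleftrightarrow>
     U \<subseteq> q ` topspace X \<and> openin X {x \<in> topspace X. q x \<in> U}"
proof -
  have "istopology (\<lambda>U. U \<subseteq> q ` topspace X \<and> openin X {x \<in> topspace X. q x \<in> U})"
    unfolding istopology_def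
  proof (intro conjI allI impI)
    fix U V
    assume "U \<subseteq> q ` topspace X \<and> openin X {x \<in> topspace X. q x \<in> U}"
      and "V \<subseteq> q ` topspace X \<and> openin X {x \<in> topspace X. q x \<in> V}"
    moreover have "{x \<in> topspace X. q x \<in> U \<inter> V}
        = {x \<in> topspace X. q x \<in> U} \<inter> {x \<in> topspace X. q x \<in> V}"
      by auto
    ultimately show "U \<inter> V \<subseteq> q ` topspace X" "openin X {x \<in> topspace X. q x \<in> U \<inter> V}"
      by auto
  next
    fix K
    assume *: "\<forall>U\<in>K. U \<subseteq> q ` topspace X \<and> openin X {x \<in> topspace X. q x \<in> U}"
    have "{x \<in> topspace X. q x \<in> \<Union>K} = (\<Union>U\<in>K. {x \<in> topspace X. q x \<in> U})"
      by auto
    then show "openin X {x \<in> topspace X. q x \<in> \<Union>K}"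
      using * by auto
    show "\<Union>K \<subseteq> q ` topspace X"
      using * by auto
  qed
  then show ?thesis
    by (simp add: quotient_topology_def topology_inverse')
qed

lemma topspace_quotient_topology: "topspace (quotient_topology X q) = q ` topspace X"
proof (rule antisym)
  show "topspace (quotient_topology X q) \<subseteq> q ` topspace X"
    by (metis openin_quotient_topology openin_topspace)
  have "{x \<in> topspace X. q x \<in> q ` topspace X} = topspace X"
    by auto
  then show "q ` topspace X \<subseteq> topspace (quotient_topology X q)"
    by (intro openin_subset) (simp add: openin_quotient_topology)
qed

lemma quotient_map_quotient_topology: "quotient_map X (quotient_topology X q) q"
  by (simp add: quotient_map_def openin_quotient_topology topspace_quotient_topology)


section \<open>Fundamental groups\<close>

definition loop_homotopic :: "'a topology \<Rightarrow> 'a \<Rightarrow> (real \<Rightarrow> 'a) \<Rightarrow> (real \<Rightarrow> 'a) \<Rightarrow> bool" where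
  "loop_homotopic X p = homotopic_with (\<lambda>h. h 0 = p \<and> h 1 = p) (top_of_set {0..1}) X"

definition loop_class :: "'a topology \<Rightarrow> 'a \<Rightarrow> (real \<Rightarrow> 'a) \<Rightarrow> (real \<Rightarrow> 'a) set" where
  "loop_class X p f = {f'. loop_homotopic X p f f'}"

definition loop_join :: "(real \<Rightarrow> 'a) \<Rightarrow> (real \<Rightarrow> 'a) \<Rightarrow> real \<Rightarrow> 'a" where
  "loop_join f f' = (\<lambda>t. if t \<le> 1/2 then f (2 * t) else f' (2 * t - 1))"

definition fundamental_group :: "'a topology \<Rightarrow> 'a \<Rightarrow> (real \<Rightarrow> 'a) set monoid" where
  "fundamental_group X p =
    \<lparr>carrier = loop_class X p ` {f. pathin X f \<and> f 0 = p \<and> f 1 = p},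
     mult = (\<lambda>C C'. \<Union>f\<in>C. \<Union>f'\<in>C'. loop_class X p (loop_join f f')),
     one = loop_class X p (\<lambda>t. p)\<rparr>"

definition induced_hom ::
    "'b topology \<Rightarrow> ('a \<Rightarrow> 'b) \<Rightarrow> 'a \<Rightarrow> (real \<Rightarrow> 'a) set \<Rightarrow> (real \<Rightarrow> 'b) set" where
  "induced_hom Y \<phi> p C = (\<Union>f\<in>C. loop_class Y (\<phi> p) (\<phi> \<circ> f))"


section \<open>Configuration spaces and braid groups\<close>

text \<open>The \<open>k\<close> coordinates of a configuration are indexed by \<open>{..<k}\<close>.\<close>

definition conf_space :: "nat \<Rightarrow> 'a topology \<Rightarrow> (nat \<Rightarrow> 'a) topology" where
  "conf_space k X = subtopology (product_topology (\<lambda>_. X) {..<k}) {x. inj_on x {..<k}}"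

definition conf_orbit :: "nat \<Rightarrow> (nat \<Rightarrow> 'a) \<Rightarrow> (nat \<Rightarrow> 'a) set" where
  "conf_orbit k x = {x \<circ> \<pi> | \<pi>. \<pi> permutes {..<k}}"

definition unordered_conf_space :: "nat \<Rightarrow> 'a topology \<Rightarrow> (nat \<Rightarrow> 'a) set topology" where
  "unordered_conf_space k X = quotient_topology (conf_space k X) (conf_orbit k)"

definition braid_group ::
    "nat \<Rightarrow> 'a topology \<Rightarrow> (nat \<Rightarrow> 'a) \<Rightarrow> (real \<Rightarrow> (nat \<Rightarrow> 'a) set) set monoid" where
  "braid_group k X x = fundamental_group (unordered_conf_space k X) (conf_orbit k x)"

text \<open>Points of a product topology are extensional functions, hence the restricted composition
  \<^const>\<open>compose\<close> instead of \<open>e \<circ> x\<close>.\<close>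

definition braid_map ::
    "nat \<Rightarrow> 'b topology \<Rightarrow> ('a \<Rightarrow> 'b) \<Rightarrow> (nat \<Rightarrow> 'a) \<Rightarrow>
     (real \<Rightarrow> (nat \<Rightarrow> 'a) set) set \<Rightarrow> (real \<Rightarrow> (nat \<Rightarrow> 'b) set) set" where
  "braid_map k Y e x =
     induced_hom (unordered_conf_space k Y) ((`) (compose {..<k} e)) (conf_orbit k x)"


section \<open>Surfaces\<close>

text \<open>For \<open>g \<ge> 1\<close>, the closed orientable surface of genus \<open>g\<close> is obtained from a disc, viewed as a
  \<open>4g\<close>-gon whose \<open>m\<close>-th side consists of the points \<open>polygon_bdry g t\<close> with \<open>m \<le> t \<le> m + 1\<close>, by
  gluing its sides according to the word
  \<open>a\<^sub>1 b\<^sub>1 a\<^sub>1\<^sup>-\<^sup>1 b\<^sub>1\<^sup>-\<^sup>1 \<dots> a\<^sub>g b\<^sub>g a\<^sub>g\<^sup>-\<^sup>1 b\<^sub>g\<^sup>-\<^sup>1\<close>.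
  The surface with one boundary component arises by first removing the open disc of radius \<open>1/2\<close>
  about the centre.\<close>

definition polygon_bdry :: "nat \<Rightarrow> real \<Rightarrow> complex" where
  "polygon_bdry g t = cis (2 * pi * t / (4 * real g))"

inductive_set side_gluing :: "nat \<Rightarrow> (complex \<times> complex) set" for g where
  a_side: "j < g \<Longrightarrow> 0 \<le> t \<Longrightarrow> t \<le> 1 \<Longrightarrow>
    (polygon_bdry g (4 * real j + t), polygon_bdry g (4 * real j + 3 - t)) \<in> side_gluing g"
| b_side: "j < g \<Longrightarrow> 0 \<le> t \<Longrightarrow> t \<le> 1 \<Longrightarrow>
    (polygon_bdry g (4 * real j + 1 + t), polygon_bdry g (4 * real j + 4 - t)) \<in> side_gluing g"

definition model_surface :: "nat \<Rightarrow> complex set topology" where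
  "model_surface g =
     quotient_topology (top_of_set {z. 1/2 \<le> cmod z \<and> cmod z \<le> 1})
       (\<lambda>z. (side_gluing g \<union> (side_gluing g)\<inverse>)\<^sup>* `` {z})"

text \<open>\<open>X\<close> is a compact connected orientable surface of genus \<open>g\<close> with one boundary component.
  Only meaningful for \<open>g \<ge> 1\<close>.\<close>

definition is_surface :: "nat \<Rightarrow> 'a topology \<Rightarrow> bool" where
  "is_surface g X \<longleftrightarrow> X homeomorphic_space model_surface g"

definition surface_interior :: "'a topology \<Rightarrow> 'a set" where
  "surface_interior X =
     {p \<in> topspace X. \<exists>U. openin X U \<and> p \<in> U \<and>
        subtopology X U homeomorphic_space (euclidean :: complex topology)}"

definition punctured :: "'a topology \<Rightarrow> 'a set \<Rightarrow> 'a topology" where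
  "punctured X P = subtopology X (topspace X - P)"

definition disc :: "complex topology" where
  "disc = top_of_set (cball 0 1)"

end

theory Submission
  imports Defs "HOL-Algebra.FiniteProduct" "HOL-Library.Function_Algebras"
begin

text \<open>In \<open>B/\<Gamma>\<^sub>3\<close> the quotient of \<open>\<sigma>\<^sub>i\<close> by \<open>\<sigma>\<^sub>i\<^sub>+\<^sub>1\<close> is a commutator by the braid
  relation, hence central, and then the braid relation forces it to be trivial. Once all
  \<open>\<sigma>\<^sub>i\<close> agree with one element \<open>\<sigma>\<close>, the remaining relations say that \<open>\<sigma>\<close> and the
  \<open>\<zeta>\<^sub>i\<close> are central, that \<open>[a\<^sub>i, b\<^sub>i] = \<sigma>\<^sup>2\<close>, and that the other pairs of generators
  commute; such a group has class at most 2. So a homomorphism kills \<open>\<Gamma>\<^sub>3\<close> if and only if it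
  identifies the \<open>\<sigma>\<^sub>i\<close>. Mapping \<open>B\<close> to an explicit Heisenberg group shows that the exponents
  of \<open>\<sigma>\<close> and the \<open>\<zeta>\<^sub>i\<close> are well defined on the image of the braid group of the disc, whence
  the injectivity of \<open>\<alpha>\<^sub>k\<close>, and that a central element has exponent \<open>0\<close> in each \<open>a\<^sub>i\<close>
  and \<open>b\<^sub>i\<close>, which identifies the centre.\<close>

section \<open>Presented groups\<close>

text \<open>Injectivity and the computation of the centre follow one pattern. Take an abelian
  quotient generated by finitely many classes, write the class of an element as a product of powers
  of these, and read the exponents off the Heisenberg group; if all of them vanish, the class is
  trivial. No basis of the abelian quotient has to be known beforehand. For injectivity the quotient
  is \<open>D Mod \<Gamma>2\<close>, but its exponents are computed in \<open>B\<close>, after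
  applying \<open>\<iota>\<close>. For the centre it is \<open>B Mod K\<close>, where
  \<open>K\<close> is the preimage under \<open>\<rho>\<close> of the image of \<open>D\<close>; it
  is abelian because \<sigma>, and with it the only obstruction \<sigma>^2, dies there. The braid
  groups themselves consist of classes of loops of configurations. Their group laws are transported
  from the presentations, whereas the homomorphism property of \<open>\<iota>\<close> is proved from
  the topology, since the hypothesis on the generators only fixes its values at these.\<close>

primrec letter_eval :: "('c, 'm) monoid_scheme \<Rightarrow> ('x \<Rightarrow> 'c) \<Rightarrow> 'x letter \<Rightarrow> 'c" where
  "letter_eval H f (Pos x) = f x"
| "letter_eval H f (Neg x) = inv\<^bsub>H\<^esub> (f x)"

definition word_eval :: "('c, 'm) monoid_scheme \<Rightarrow> ('x \<Rightarrow> 'c) \<Rightarrow> 'x letter list \<Rightarrow> 'c" where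
  "word_eval H f w = foldr (\<lambda>l acc. letter_eval H f l \<otimes>\<^bsub>H\<^esub> acc) w \<one>\<^bsub>H\<^esub>"

lemma word_eval_Nil [simp]: "word_eval H f [] = \<one>\<^bsub>H\<^esub>"
  by (simp add: word_eval_def)

lemma word_eval_Cons [simp]: "word_eval H f (l # w) = letter_eval H f l \<otimes>\<^bsub>H\<^esub> word_eval H f w"
  by (simp add: word_eval_def)

primrec letter_inv :: "'x letter \<Rightarrow> 'x letter" where
  "letter_inv (Pos x) = Neg x"
| "letter_inv (Neg x) = Pos x"

lemma words_Nil [simp]: "[] \<in> words X"
  by (simp add: words_def)

lemma words_Pos [simp]: "Pos x # w \<in> words X \<longleftrightarrow> x \<in> X \<and> w \<in> words X"
  by (auto simp: words_def)

lemma words_Neg [simp]: "Neg x # w \<in> words X \<longleftrightarrow> x \<in> X \<and> w \<in> words X"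
  by (auto simp: words_def)

lemma words_append [simp]: "u @ v \<in> words X \<longleftrightarrow> u \<in> words X \<and> v \<in> words X"
  by (auto simp: words_def)

lemma words_inv: "w \<in> words X \<Longrightarrow> rev (map letter_inv w) \<in> words X"
proof (induction w)
  case (Cons l w)
  then show ?case by (cases l) auto
qed auto

lemma word_equiv_words: "(u, v) \<in> word_equiv X R \<Longrightarrow> u \<in> words X \<and> v \<in> words X"
  by (induction rule: word_equiv.induct) auto

lemma equiv_word_equiv: "equiv (words X) (word_equiv X R)"
proof (rule equivI)
  show "word_equiv X R \<subseteq> words X \<times> words X"
    using word_equiv_words by auto
  show "refl_on (words X) (word_equiv X R)"
    by (auto intro!: refl_onI word_equiv.refl)
  show "Relation.sym (word_equiv X R)"
    by (auto intro!: symI word_equiv.sym)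
  show "Relation.trans (word_equiv X R)"
    by (auto intro!: transI intro: word_equiv.trans)
qed

text \<open>Congruence is not one of the rules of \<open>word_equiv\<close>; it holds because every
  generating rule already carries a context that absorbs \<open>s\<close> and
  \<open>t\<close>.\<close>

lemma word_equiv_context:
  assumes "(u, v) \<in> word_equiv X R" "s \<in> words X" "t \<in> words X"
  shows "(s @ u @ t, s @ v @ t) \<in> word_equiv X R"
  using assms
proof (induction rule: word_equiv.induct)
  case (refl w)
  then show ?case by (auto intro: word_equiv.refl)
next
  case (sym u v)
  then show ?case by (auto intro: word_equiv.sym)
next
  case (trans u v w)
  then show ?case by (auto intro: word_equiv.trans)
next
  case (cancel_pos_neg u v x)
  then show ?case using word_equiv.cancel_pos_neg[of "s @ u" X "v @ t" x R] by simp
next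
  case (cancel_neg_pos u v x)
  then show ?case using word_equiv.cancel_neg_pos[of "s @ u" X "v @ t" x R] by simp
next
  case (relation u v l r)
  then show ?case using word_equiv.relation[of "s @ u" X "v @ t" l r R] by simp
qed

lemma word_equiv_append:
  assumes "(u, u') \<in> word_equiv X R" "(v, v') \<in> word_equiv X R"
  shows "(u @ v, u' @ v') \<in> word_equiv X R"
  using word_equiv_context[OF assms(1), of "[]" v] word_equiv_context[OF assms(2), of u' "[]"]
    word_equiv_words[OF assms(1)] word_equiv_words[OF assms(2)]
  by (auto intro: word_equiv.trans)

lemma word_equiv_inv:
  "w \<in> words X \<Longrightarrow> (rev (map letter_inv w) @ w, []) \<in> word_equiv X R"
proof (induction w)
  case (Cons l w)
  then have w: "w \<in> words X" "rev (map letter_inv w) \<in> words X"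
    by (cases l; auto intro: words_inv)+
  \<comment> \<open>Reversal puts the inverse of \<open>l\<close> right before \<open>l\<close>, so
    the cancellation starts in the middle.\<close>
  have "(rev (map letter_inv w) @ [letter_inv l, l] @ w, rev (map letter_inv w) @ w) \<in> word_equiv X R"
    using Cons.prems w by (cases l) (auto intro: word_equiv.cancel_pos_neg[simplified] word_equiv.cancel_neg_pos[simplified])
  then show ?case
    using Cons.IH w(1) by (auto intro: word_equiv.trans)
qed (auto intro: word_equiv.refl)

text \<open>The multiplication is a union over all representatives; concatenation respects
  \<open>word_equiv\<close>, so every pair contributes the same class.\<close>

lemma presented_group_mult:
  assumes "u \<in> words X" "v \<in> words X"
  shows "(word_equiv X R `` {u}) \<otimes>\<^bsub>presented_group X R\<^esub> (word_equiv X R `` {v})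
      = word_equiv X R `` {u @ v}"
proof -
  have "congruent2 (word_equiv X R) (word_equiv X R) (\<lambda>u v. word_equiv X R `` {u @ v})"
    by (rule congruent2I') (rule equiv_class_eq[OF equiv_word_equiv word_equiv_append])
  from UN_equiv_class2[OF equiv_word_equiv equiv_word_equiv this assms]
  show ?thesis by (simp add: presented_group_def)
qed

lemma presented_group_carrierE:
  assumes "U \<in> carrier (presented_group X R)"
  obtains u where "u \<in> words X" "U = word_equiv X R `` {u}"
  using assms by (auto simp: presented_group_def elim: quotientE)

lemma presented_group_carrierI:
  "u \<in> words X \<Longrightarrow> word_equiv X R `` {u} \<in> carrier (presented_group X R)"
  by (auto simp: presented_group_def intro: quotientI)

lemma presented_group_one: "\<one>\<^bsub>presented_group X R\<^esub> = word_equiv X R `` {[]}"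
  by (simp add: presented_group_def)

lemma group_presented_group: "group (presented_group X R)"
proof (rule groupI)
  fix U assume "U \<in> carrier (presented_group X R)"
  then obtain u where u: "u \<in> words X" "U = word_equiv X R `` {u}"
    by (rule presented_group_carrierE)
  then show "\<one>\<^bsub>presented_group X R\<^esub> \<otimes>\<^bsub>presented_group X R\<^esub> U = U"
    by (simp add: presented_group_one presented_group_mult)
  show "\<exists>V\<in>carrier (presented_group X R). V \<otimes>\<^bsub>presented_group X R\<^esub> U = \<one>\<^bsub>presented_group X R\<^esub>"
  proof (rule bexI)
    show "word_equiv X R `` {rev (map letter_inv u)} \<in> carrier (presented_group X R)"
      using u by (intro presented_group_carrierI words_inv)
    show "word_equiv X R `` {rev (map letter_inv u)} \<otimes>\<^bsub>presented_group X R\<^esub> U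
        = \<one>\<^bsub>presented_group X R\<^esub>"
      using u words_inv[OF u(1)] equiv_class_eq[OF equiv_word_equiv word_equiv_inv[OF u(1)]]
      by (simp add: presented_group_one presented_group_mult)
  qed
qed (auto elim!: presented_group_carrierE
    simp: presented_group_mult presented_group_one presented_group_carrierI)

section \<open>Evaluation of words and homomorphisms out of a presented group\<close>

lemma (in group) letter_eval_closed:
  assumes "f \<in> X \<rightarrow> carrier G" "[l] \<in> words X"
  shows "letter_eval G f l \<in> carrier G"
  using assms by (cases l) auto

lemma (in group) word_eval_closed:
  assumes "f \<in> X \<rightarrow> carrier G" "w \<in> words X"
  shows "word_eval G f w \<in> carrier G"
  using assms(2)
proof (induction w)
  case (Cons l w)
  then have "[l] \<in> words X" "w \<in> words X" by (cases l; simp)+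
  then show ?case using Cons letter_eval_closed[OF assms(1)] by auto
qed auto

lemma (in group) word_eval_append:
  assumes "f \<in> X \<rightarrow> carrier G" "u \<in> words X" "v \<in> words X"
  shows "word_eval G f (u @ v) = word_eval G f u \<otimes> word_eval G f v"
  using assms(2)
proof (induction u)
  case Nil
  then show ?case using word_eval_closed[OF assms(1,3)] by simp
next
  case (Cons l u)
  then have "[l] \<in> words X" "u \<in> words X" by (cases l; simp)+
  then show ?case
    using Cons letter_eval_closed[OF assms(1)] word_eval_closed[OF assms(1)] assms(3)
    by (simp add: m_assoc)
qed

lemma (in group) word_eval_equiv:
  assumes f: "f \<in> X \<rightarrow> carrier G"
    and R: "\<And>l r. (l, r) \<in> R \<Longrightarrow> l \<in> words X \<Longrightarrow> r \<in> words X \<Longrightarrow> word_eval G f l = word_eval G f r"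
    and "(u, v) \<in> word_equiv X R"
  shows "word_eval G f u = word_eval G f v"
  using assms(3)
proof (induction rule: word_equiv.induct)
  case (cancel_pos_neg u v x)
  then have "f x \<in> carrier G" using f by auto
  with cancel_pos_neg show ?case
    using word_eval_closed[OF f] by (simp add: word_eval_append[OF f] flip: m_assoc)
next
  case (cancel_neg_pos u v x)
  then have "f x \<in> carrier G" using f by auto
  with cancel_neg_pos show ?case
    using word_eval_closed[OF f] by (simp add: word_eval_append[OF f] flip: m_assoc)
next
  case (relation u v l r)
  then show ?case by (simp add: word_eval_append[OF f] R)
qed auto

lemma presented_group_hom:
  assumes "group H" and f: "f \<in> X \<rightarrow> carrier H"
    and R: "\<And>l r. (l, r) \<in> R \<Longrightarrow> l \<in> words X \<Longrightarrow> r \<in> words X \<Longrightarrow> word_eval H f l = word_eval H f r"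
  shows "\<exists>h\<in>hom (presented_group X R) H. \<forall>w\<in>words X. h (word_equiv X R `` {w}) = word_eval H f w"
proof -
  interpret H: group H by fact
  \<comment> \<open>Any representative will do: by \<open>word_eval_equiv\<close> the value depends
    only on the class.\<close>
  define h where "h U = word_eval H f (SOME u. u \<in> U)" for U
  have h: "h (word_equiv X R `` {w}) = word_eval H f w" if "w \<in> words X" for w
  proof -
    have "w \<in> word_equiv X R `` {w}" using that by (auto intro: word_equiv.refl)
    then have "(SOME u. u \<in> word_equiv X R `` {w}) \<in> word_equiv X R `` {w}" by (rule someI)
    then have "(w, SOME u. u \<in> word_equiv X R `` {w}) \<in> word_equiv X R" by simp
    from H.word_eval_equiv[OF f R this] show ?thesis by (simp add: h_def)
  qed
  have "h \<in> hom (presented_group X R) H"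
    by (auto intro!: homI elim!: presented_group_carrierE
        simp: h presented_group_mult H.word_eval_closed[OF f] H.word_eval_append[OF f])
  with h show ?thesis by blast
qed

lemma hom_letter_eval:
  assumes "group B" "group H" "h \<in> hom B H" "\<gamma> \<in> X \<rightarrow> carrier B" "[l] \<in> words X"
  shows "h (letter_eval B \<gamma> l) = letter_eval H (h \<circ> \<gamma>) l"
proof -
  interpret group_hom B H h
    using assms by (simp add: group_hom_def group_hom_axioms_def)
  show ?thesis using assms by (cases l) (auto simp: Pi_iff)
qed

lemma hom_word_eval:
  assumes "group B" "group H" "h \<in> hom B H" "\<gamma> \<in> X \<rightarrow> carrier B" "w \<in> words X"
  shows "h (word_eval B \<gamma> w) = word_eval H (h \<circ> \<gamma>) w"
  using assms(5)
proof (induction w)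
  case Nil
  then show ?case using hom_one[OF assms(3,1,2)] by simp
next
  case (Cons l w)
  then have lw: "[l] \<in> words X" "w \<in> words X" by (cases l; simp)+
  then show ?case
    using Cons hom_letter_eval[OF assms(1-4) lw(1)]
      group.letter_eval_closed[OF assms(1) assms(4) lw(1)]
      group.word_eval_closed[OF assms(1) assms(4) lw(2)]
    by (simp add: hom_mult[OF assms(3)] del: o_apply)
qed

text \<open>The unit is checked separately because nothing else in \<^const>\<open>has_presentation\<close> ties the
  unit of \<open>B\<close> to its multiplication.\<close>

lemma has_presentation_group:
  assumes "has_presentation B gen X R"
    and one: "\<one>\<^bsub>B\<^esub> \<in> carrier B" "\<one>\<^bsub>B\<^esub> \<otimes>\<^bsub>B\<^esub> \<one>\<^bsub>B\<^esub> = \<one>\<^bsub>B\<^esub>"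
  shows "group B"
proof -
  define P where "P = presented_group X R"
  interpret P: group P unfolding P_def by (rule group_presented_group)
  obtain f where f: "f \<in> hom P B" "bij_betw f (carrier P) (carrier B)"
    using assms(1) by (auto simp: has_presentation_def iso_def P_def)
  have im: "f ` carrier P = carrier B" using f(2) by (auto simp: bij_betw_def)
  have inj: "inj_on f (carrier P)" using f(2) by (auto simp: bij_betw_def)
  have mult: "f u \<otimes>\<^bsub>B\<^esub> f v = f (u \<otimes>\<^bsub>P\<^esub> v)" if "u \<in> carrier P" "v \<in> carrier P" for u v
    using that f(1) by (simp add: hom_mult)
  obtain e where e: "e \<in> carrier P" "f e = \<one>\<^bsub>B\<^esub>" using one im by (metis imageE)
  \<comment> \<open>The preimage \<open>e\<close> of the unit of \<open>B\<close> is idempotent, and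
    the only idempotent of a group is its unit.\<close>
  have "f (e \<otimes>\<^bsub>P\<^esub> e) = f e" using e one by (simp flip: mult)
  then have "e \<otimes>\<^bsub>P\<^esub> e = e" using inj_onD[OF inj _ P.m_closed[OF e(1) e(1)] e(1)] by simp
  then have e1: "e = \<one>\<^bsub>P\<^esub>" using e by (simp add: P.r_cancel_one)
  show ?thesis
  proof (rule groupI)
    show "\<one>\<^bsub>B\<^esub> \<in> carrier B" by (fact one)
    fix x assume "x \<in> carrier B"
    then obtain u where u: "u \<in> carrier P" "x = f u" using im by blast
    show "\<one>\<^bsub>B\<^esub> \<otimes>\<^bsub>B\<^esub> x = x" using u e e1 by (simp flip: e(2) add: mult)
    have "f (inv\<^bsub>P\<^esub> u) \<otimes>\<^bsub>B\<^esub> x = \<one>\<^bsub>B\<^esub>" using u e e1 by (simp flip: e(2) add: mult)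
    then show "\<exists>y\<in>carrier B. y \<otimes>\<^bsub>B\<^esub> x = \<one>\<^bsub>B\<^esub>" using u im by blast
    fix y assume "y \<in> carrier B"
    then obtain v where v: "v \<in> carrier P" "y = f v" using im by blast
    show "x \<otimes>\<^bsub>B\<^esub> y \<in> carrier B" using u v im by (auto simp: mult)
    fix z assume "z \<in> carrier B"
    then obtain w where w: "w \<in> carrier P" "z = f w" using im by blast
    show "x \<otimes>\<^bsub>B\<^esub> y \<otimes>\<^bsub>B\<^esub> z = x \<otimes>\<^bsub>B\<^esub> (y \<otimes>\<^bsub>B\<^esub> z)"
      using u v w by (simp add: mult P.m_assoc)
  qed
qed

section \<open>Groups with a given presentation\<close>

locale presented = group B for B (structure) +
  fixes gen :: "'x \<Rightarrow> 'b" and X :: "'x set" and R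
  assumes pres: "has_presentation B gen X R"
begin

lemma presentation_iso:
  obtains f where "f \<in> iso (presented_group X R) B"
    "\<And>w. w \<in> words X \<Longrightarrow> f (word_equiv X R `` {w}) = word_eval B gen w"
    "gen \<in> X \<rightarrow> carrier B"
proof -
  define P where "P = presented_group X R"
  interpret P: group P unfolding P_def by (rule group_presented_group)
  obtain f where f: "f \<in> iso P B" "\<And>x. x \<in> X \<Longrightarrow> f (word_equiv X R `` {[Pos x]}) = gen x"
    using pres by (auto simp: has_presentation_def P_def)
  then have fh: "f \<in> hom P B" by (simp add: iso_def)
  interpret f: group_hom P B f
    using fh by unfold_locales
  have cP: "word_equiv X R `` {w} \<in> carrier P" if "w \<in> words X" for w
    using that by (simp add: P_def presented_group_carrierI)
  have gen: "gen \<in> X \<rightarrow> carrier B"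
  proof
    fix x assume "x \<in> X"
    then show "gen x \<in> carrier B" using f.hom_closed[OF cP[of "[Pos x]"]] f(2)[of x] by simp
  qed
  \<comment> \<open>\<open>has_presentation\<close> prescribes \<open>f\<close> on positive letters
    only; on negative ones the value is forced by uniqueness of inverses.\<close>
  have neg: "f (word_equiv X R `` {[Neg x]}) = inv gen x" if "x \<in> X" for x
  proof -
    have "word_equiv X R `` {[Neg x]} \<otimes>\<^bsub>P\<^esub> word_equiv X R `` {[Pos x]} = \<one>\<^bsub>P\<^esub>"
      using that word_equiv.cancel_neg_pos[of "[]" X "[]" x R]
      by (simp add: P_def presented_group_mult presented_group_one equiv_class_eq[OF equiv_word_equiv])
    moreover have c: "word_equiv X R `` {[Neg x]} \<in> carrier P" "word_equiv X R `` {[Pos x]} \<in> carrier P"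
      using that cP by auto
    ultimately have "f (word_equiv X R `` {[Neg x]}) \<otimes> gen x = \<one>"
      using that f.hom_mult[OF c] f.hom_one by (simp add: f(2))
    then show ?thesis
      using c that gen f.hom_closed by (intro inv_equality[symmetric]) (auto simp: Pi_iff)
  qed
  have "f (word_equiv X R `` {w}) = word_eval B gen w" if "w \<in> words X" for w
    using that
  proof (induction w)
    case Nil
    then show ?case using f.hom_one by (simp add: P_def presented_group_one)
  next
    case (Cons l w)
    then have lw: "[l] \<in> words X" "w \<in> words X" by (cases l; simp)+
    then have "f (word_equiv X R `` {[l] @ w}) = f (word_equiv X R `` {[l]}) \<otimes> f (word_equiv X R `` {w})"
      using f.hom_mult[OF cP[OF lw(1)] cP[OF lw(2)]] presented_group_mult[OF lw, of R]
      by (simp add: P_def)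
    moreover have "f (word_equiv X R `` {[l]}) = letter_eval B gen l"
      using lw f(2) neg by (cases l) auto
    ultimately show ?case using Cons lw by simp
  qed
  with f gen show thesis using that by (simp add: P_def)
qed

lemma gen_funcset: "gen \<in> X \<rightarrow> carrier B"
  by (rule presentation_iso)

lemma gen_closed [simp]: "x \<in> X \<Longrightarrow> gen x \<in> carrier B"
  using gen_funcset by auto

lemma carrierE:
  assumes "b \<in> carrier B"
  obtains w where "w \<in> words X" "b = word_eval B gen w"
proof -
  obtain f where f: "f \<in> iso (presented_group X R) B"
    "\<And>w. w \<in> words X \<Longrightarrow> f (word_equiv X R `` {w}) = word_eval B gen w"
    using presentation_iso by metis
  then have "b \<in> f ` carrier (presented_group X R)"
    using assms by (auto simp: iso_def bij_betw_def)
  then show thesis using f that by (auto elim!: presented_group_carrierE)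
qed

lemma gen_induct [consumes 1, case_names one gen inv mult]:
  assumes "b \<in> carrier B" and "P \<one>" and gen: "\<And>x. x \<in> X \<Longrightarrow> P (gen x)"
    and inv: "\<And>b. b \<in> carrier B \<Longrightarrow> P b \<Longrightarrow> P (inv b)"
    and mult: "\<And>b c. b \<in> carrier B \<Longrightarrow> c \<in> carrier B \<Longrightarrow> P b \<Longrightarrow> P c \<Longrightarrow> P (b \<otimes> c)"
  shows "P b"
proof -
  obtain w where w: "w \<in> words X" "b = word_eval B gen w"
    using assms(1) by (rule carrierE)
  have "P (word_eval B gen w)" using w(1)
  proof (induction w)
    case (Cons l w)
    then have lw: "[l] \<in> words X" "w \<in> words X" by (cases l; simp)+
    then have "P (letter_eval B gen l)" using gen inv by (cases l) auto
    then show ?case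
      using Cons lw mult letter_eval_closed[OF gen_funcset] word_eval_closed[OF gen_funcset] by simp
  qed (use assms in simp)
  with w show ?thesis by simp
qed

lemma relation_holds:
  assumes "(l, r) \<in> R" "l \<in> words X" "r \<in> words X"
  shows "word_eval B gen l = word_eval B gen r"
proof -
  obtain f where "\<And>w. w \<in> words X \<Longrightarrow> f (word_equiv X R `` {w}) = word_eval B gen w"
    using presentation_iso by metis
  moreover have "word_equiv X R `` {l} = word_equiv X R `` {r}"
    using assms word_equiv.relation[of "[]" X "[]" l r R]
    by (simp add: equiv_class_eq[OF equiv_word_equiv])
  ultimately show ?thesis using assms by metis
qed

lemma hom_relation:
  assumes "group H" "h \<in> hom B H" "(l, r) \<in> R" "l \<in> words X" "r \<in> words X"
  shows "word_eval H (h \<circ> gen) l = word_eval H (h \<circ> gen) r"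
  using assms relation_holds[OF assms(3-5)] hom_word_eval[OF group_axioms assms(1,2) gen_funcset]
  by metis

lemma universal_property:
  assumes "group H" "f \<in> X \<rightarrow> carrier H"
    and "\<And>l r. (l, r) \<in> R \<Longrightarrow> l \<in> words X \<Longrightarrow> r \<in> words X \<Longrightarrow> word_eval H f l = word_eval H f r"
  obtains h where "h \<in> hom B H" "\<And>x. x \<in> X \<Longrightarrow> h (gen x) = f x"
proof -
  define P where "P = presented_group X R"
  interpret P: group P unfolding P_def by (rule group_presented_group)
  interpret H: group H by fact
  obtain j where j: "j \<in> iso P B"
    "\<And>w. w \<in> words X \<Longrightarrow> j (word_equiv X R `` {w}) = word_eval B gen w"
    using presentation_iso unfolding P_def by metis
  obtain h where h: "h \<in> hom P H" "\<And>w. w \<in> words X \<Longrightarrow> h (word_equiv X R `` {w}) = word_eval H f w"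
    using presented_group_hom[OF assms] unfolding P_def by blast
  let ?k = "inv_into (carrier P) j"
  have k: "?k \<in> hom B P" using P.iso_set_sym[OF j(1)] by (simp add: iso_def)
  show thesis
  proof (rule that)
    show "h \<circ> ?k \<in> hom B H" by (rule Group.hom_compose[OF k h(1)])
    fix x assume x: "x \<in> X"
    have "?k (gen x) = word_equiv X R `` {[Pos x]}"
    proof (rule inv_into_f_eq)
      show "inj_on j (carrier P)" using j(1) by (auto simp: iso_def bij_betw_def)
      show "word_equiv X R `` {[Pos x]} \<in> carrier P"
        using x by (simp add: P_def presented_group_carrierI)
      show "j (word_equiv X R `` {[Pos x]}) = gen x" using x j(2) by simp
    qed
    then show "(h \<circ> ?k) (gen x) = f x"
      using x h(2)[of "[Pos x]"] assms(2) by (auto simp: Pi_iff)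
  qed
qed

end

section \<open>Braid groups and the maps between them\<close>

lemma loop_homotopic_refl:
  "pathin X f \<Longrightarrow> f 0 = p \<Longrightarrow> f 1 = p \<Longrightarrow> loop_homotopic X p f f"
  by (simp add: loop_homotopic_def pathin_def)

lemma loop_homotopic_sym: "loop_homotopic X p f f' \<Longrightarrow> loop_homotopic X p f' f"
  unfolding loop_homotopic_def by (rule homotopic_with_symD)

lemma loop_homotopic_trans:
  "loop_homotopic X p f f' \<Longrightarrow> loop_homotopic X p f' f'' \<Longrightarrow> loop_homotopic X p f f''"
  unfolding loop_homotopic_def by (rule homotopic_with_trans)

lemma loop_homotopic_imp_loop:
  assumes "loop_homotopic X p f f'"
  shows "pathin X f" "f 0 = p" "f 1 = p"
  using homotopic_with_imp_continuous_maps[OF assms[unfolded loop_homotopic_def]]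
    homotopic_with_imp_property[OF assms[unfolded loop_homotopic_def]]
  by (auto simp: pathin_def)

lemma loop_class_eq: "loop_homotopic X p f f' \<Longrightarrow> loop_class X p f = loop_class X p f'"
  unfolding loop_class_def by (blast intro: loop_homotopic_sym loop_homotopic_trans)

text \<open>Both homotopies keep the end points at \<open>p\<close>, so placing them side by side in
  the loop parameter, which is the second coordinate, gives matching values at 1/2.\<close>

lemma loop_homotopic_join:
  assumes "loop_homotopic X p f f1" and "loop_homotopic X p g g1"
  shows "loop_homotopic X p (loop_join f g) (loop_join f1 g1)"
proof -
  let ?I = "top_of_set {0..1::real}"
  obtain h where h: "continuous_map (prod_topology ?I ?I) X h"
      "\<And>x. h (0, x) = f x" "\<And>x. h (1, x) = f1 x" "\<And>t. t \<in> {0..1} \<Longrightarrow> h (t, 0) = p \<and> h (t, 1) = p"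
    using assms(1) by (auto simp: loop_homotopic_def homotopic_with_def)
  obtain k where k: "continuous_map (prod_topology ?I ?I) X k"
      "\<And>x. k (0, x) = g x" "\<And>x. k (1, x) = g1 x" "\<And>t. t \<in> {0..1} \<Longrightarrow> k (t, 0) = p \<and> k (t, 1) = p"
    using assms(2) by (auto simp: loop_homotopic_def homotopic_with_def)
  define j where "j = (\<lambda>y::real \<times> real. if snd y \<le> 1/2 then h (fst y, 2 * snd y) else k (fst y, 2 * snd y - 1))"
  have I: "prod_topology ?I ?I = top_of_set ({0..1} \<times> {0..1})"
    by (simp add: prod_topology_subtopology(1) subtopology_subtopology prod_topology_subtopology Times_Int_Times)
  have sub: "subtopology (prod_topology ?I ?I) {x \<in> topspace (prod_topology ?I ?I). P x}
      = top_of_set {x \<in> {0..1} \<times> {0..1}. P x}" for P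
    unfolding I subtopology_subtopology by (rule arg_cong[where f = top_of_set]) auto
  have "continuous_map (prod_topology ?I ?I) X j"
    unfolding j_def
  proof (rule continuous_map_cases_le)
    show "continuous_map (prod_topology ?I ?I) euclideanreal snd"
      "continuous_map (prod_topology ?I ?I) euclideanreal (\<lambda>_. 1/2)"
      unfolding I by (auto intro: continuous_intros)
    have c1: "continuous_map (top_of_set {x \<in> {0..1} \<times> {0..1}. snd x \<le> 1/2}) (prod_topology ?I ?I) (\<lambda>x::real\<times>real. (fst x, 2 * snd x))"
      unfolding I by (auto intro!: continuous_intros)
    show "continuous_map (subtopology (prod_topology ?I ?I)
        {x \<in> topspace (prod_topology ?I ?I). snd x \<le> 1/2}) X (\<lambda>x. h (fst x, 2 * snd x))"
      unfolding sub using continuous_map_compose[OF c1 h(1)] by (simp only: o_def)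
    have c2: "continuous_map (top_of_set {x \<in> {0..1} \<times> {0..1}. 1/2 \<le> snd x}) (prod_topology ?I ?I) (\<lambda>x::real\<times>real. (fst x, 2 * snd x - 1))"
      unfolding I by (auto intro!: continuous_intros)
    show "continuous_map (subtopology (prod_topology ?I ?I)
        {x \<in> topspace (prod_topology ?I ?I). 1/2 \<le> snd x}) X (\<lambda>x. k (fst x, 2 * snd x - 1))"
      unfolding sub using continuous_map_compose[OF c2 k(1)] by (simp only: o_def)
    show "h (fst y, 2 * snd y) = k (fst y, 2 * snd y - 1)"
      if "y \<in> topspace (prod_topology ?I ?I)" "snd y = 1/2" for y
    proof -
      have "2 * snd y = 1" "fst y \<in> {0..1}" using that by auto
      then show ?thesis using h(4)[of "fst y"] k(4)[of "fst y"] by simp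
    qed
  qed
  moreover have "j (t, 0) = p \<and> j (t, 1) = p" if "t \<in> {0..1}" for t
    using that h(4) k(4) by (auto simp: j_def)
  ultimately show ?thesis
    unfolding loop_homotopic_def homotopic_with_def
    by (intro exI[of _ j]) (auto simp: j_def loop_join_def h k)
qed

lemma fundamental_group_mult:
  assumes "pathin X f" "f 0 = p" "f 1 = p" "pathin X g" "g 0 = p" "g 1 = p"
  shows "loop_class X p f \<otimes>\<^bsub>fundamental_group X p\<^esub> loop_class X p g = loop_class X p (loop_join f g)"
proof -
  have "loop_class X p (loop_join f' g') = loop_class X p (loop_join f g)"
    if "f' \<in> loop_class X p f" "g' \<in> loop_class X p g" for f' g'
    using that by (intro loop_class_eq[symmetric] loop_homotopic_join) (simp_all add: loop_class_def)
  then have "(\<Union>g'\<in>loop_class X p g. loop_class X p (loop_join f' g')) = loop_class X p (loop_join f g)"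
    if "f' \<in> loop_class X p f" for f'
    using that assms loop_homotopic_refl[of X g p] by (intro SUP_eq_const) (auto simp: loop_class_def)
  \<comment> \<open>A union of equal sets is that set only over a nonempty index set. The class is
    nonempty because \<open>f\<close>, being a loop, is homotopic to itself.\<close>
  moreover have "loop_class X p f \<noteq> {}"
    using assms by (auto simp: loop_class_def dest: loop_homotopic_refl)
  ultimately have "(\<Union>f'\<in>loop_class X p f. \<Union>g'\<in>loop_class X p g. loop_class X p (loop_join f' g'))
      = loop_class X p (loop_join f g)"
    by (rule SUP_eq_const[rotated])
  then show ?thesis by (simp add: fundamental_group_def)
qed

text \<open>These are the two facts on the unit that \<open>has_presentation_group\<close> asks for.
  The join of two constant loops is literally constant, so no homotopy is constructed.\<close>

lemma fundamental_group_one: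
  assumes "p \<in> topspace X"
  shows "\<one>\<^bsub>fundamental_group X p\<^esub> \<in> carrier (fundamental_group X p)"
    and "\<one>\<^bsub>fundamental_group X p\<^esub> \<otimes>\<^bsub>fundamental_group X p\<^esub> \<one>\<^bsub>fundamental_group X p\<^esub> = \<one>\<^bsub>fundamental_group X p\<^esub>"
proof -
  have one: "\<one>\<^bsub>fundamental_group X p\<^esub> = loop_class X p (\<lambda>_. p)"
    by (simp add: fundamental_group_def)
  have const: "pathin X (\<lambda>_. p)" using assms by (simp add: pathin_def)
  then show "\<one>\<^bsub>fundamental_group X p\<^esub> \<in> carrier (fundamental_group X p)"
    by (auto simp: fundamental_group_def)
  have "loop_join (\<lambda>_. p) (\<lambda>_. p) = (\<lambda>_. p)" by (simp add: loop_join_def)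
  then show "\<one>\<^bsub>fundamental_group X p\<^esub> \<otimes>\<^bsub>fundamental_group X p\<^esub> \<one>\<^bsub>fundamental_group X p\<^esub> = \<one>\<^bsub>fundamental_group X p\<^esub>"
    using const by (simp add: one fundamental_group_mult)
qed

lemma induced_hom_loop_class:
  assumes \<phi>: "continuous_map X Y \<phi>" and f: "pathin X f" "f 0 = p" "f 1 = p"
  shows "induced_hom Y \<phi> p (loop_class X p f) = loop_class Y (\<phi> p) (\<phi> \<circ> f)"
proof -
  have "loop_class Y (\<phi> p) (\<phi> \<circ> f') = loop_class Y (\<phi> p) (\<phi> \<circ> f)" if "f' \<in> loop_class X p f" for f'
  proof -
    have "loop_homotopic X p f' f" using that by (simp add: loop_class_def loop_homotopic_sym)
    then have "loop_homotopic Y (\<phi> p) (\<phi> \<circ> f') (\<phi> \<circ> f)"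
      unfolding loop_homotopic_def by (rule homotopic_with_compose_continuous_map_left[OF _ \<phi>]) auto
    then show ?thesis by (rule loop_class_eq)
  qed
  moreover have "loop_class X p f \<noteq> {}"
    using f by (auto simp: loop_class_def dest: loop_homotopic_refl)
  ultimately show ?thesis unfolding induced_hom_def by (intro SUP_eq_const) simp_all
qed

lemma induced_hom_hom:
  assumes \<phi>: "continuous_map X Y \<phi>"
  shows "induced_hom Y \<phi> p \<in> hom (fundamental_group X p) (fundamental_group Y (\<phi> p))"
proof (rule homI)
  fix C assume "C \<in> carrier (fundamental_group X p)"
  then obtain f where f: "C = loop_class X p f" "pathin X f" "f 0 = p" "f 1 = p"
    by (auto simp: fundamental_group_def)
  have \<phi>f: "pathin Y (\<phi> \<circ> f)" using f \<phi> by (auto simp: pathin_def intro: continuous_map_compose)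
  then show "induced_hom Y \<phi> p C \<in> carrier (fundamental_group Y (\<phi> p))"
    using f by (auto simp: induced_hom_loop_class[OF \<phi>] fundamental_group_def)
  fix C' assume "C' \<in> carrier (fundamental_group X p)"
  then obtain g where g: "C' = loop_class X p g" "pathin X g" "g 0 = p" "g 1 = p"
    by (auto simp: fundamental_group_def)
  have \<phi>g: "pathin Y (\<phi> \<circ> g)" using g \<phi> by (auto simp: pathin_def intro: continuous_map_compose)
  \<comment> \<open>That the join is again a loop is read off from its homotopy to itself.\<close>
  have "loop_homotopic X p (loop_join f g) (loop_join f g)"
    using f g by (intro loop_homotopic_join loop_homotopic_refl)
  note fg = loop_homotopic_imp_loop[OF this]
  have "\<phi> \<circ> loop_join f g = loop_join (\<phi> \<circ> f) (\<phi> \<circ> g)" by (auto simp: loop_join_def)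
  then show "induced_hom Y \<phi> p (C \<otimes>\<^bsub>fundamental_group X p\<^esub> C')
      = induced_hom Y \<phi> p C \<otimes>\<^bsub>fundamental_group Y (\<phi> p)\<^esub> induced_hom Y \<phi> p C'"
    using f g fg \<phi>f \<phi>g by (simp add: fundamental_group_mult induced_hom_loop_class[OF \<phi>])
qed

section \<open>Maps of configuration spaces induced by injective continuous maps\<close>

lemma conf_orbit_in_topspace:
  "x \<in> topspace (conf_space k X) \<Longrightarrow> conf_orbit k x \<in> topspace (unordered_conf_space k X)"
  by (simp add: unordered_conf_space_def topspace_quotient_topology)

lemma compose_conf_orbit:
  "compose {..<k} e ` conf_orbit k x = conf_orbit k (compose {..<k} e x)"
proof -
  have "compose {..<k} e (x \<circ> \<pi>) = compose {..<k} e x \<circ> \<pi>" if "\<pi> permutes {..<k}" for \<pi>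
  proof
    fix i
    \<comment> \<open>Outside \<open>{..<k}\<close> restricted composition returns
      \<open>undefined\<close>, and \<pi> preserves this range, so both sides take the default value
      at the same places.\<close>
    have "\<pi> i < k \<longleftrightarrow> i < k" using permutes_in_image[OF that] by auto
    then show "compose {..<k} e (x \<circ> \<pi>) i = (compose {..<k} e x \<circ> \<pi>) i" by (simp add: compose_def)
  qed
  then show ?thesis by (force simp: conf_orbit_def)
qed

lemma continuous_map_compose_conf:
  assumes e: "continuous_map X Y e" "inj_on e (topspace X)"
  shows "continuous_map (conf_space k X) (conf_space k Y) (compose {..<k} e)"
  unfolding conf_space_def continuous_map_in_subtopology
proof
  have "continuous_map (product_topology (\<lambda>_. X) {..<k}) Y (\<lambda>x. e (x i))" if "i < k" for i
    using continuous_map_compose[OF continuous_map_product_projection[of i "{..<k}" "\<lambda>_. X"] e(1)] that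
    by (simp add: o_def)
  then show "continuous_map (subtopology (product_topology (\<lambda>_. X) {..<k}) {x. inj_on x {..<k}})
      (product_topology (\<lambda>_. Y) {..<k}) (compose {..<k} e)"
    by (intro continuous_map_from_subtopology)
      (auto simp: continuous_map_componentwise compose_def extensional_def)
  show "compose {..<k} e \<in> topspace (subtopology (product_topology (\<lambda>_. X) {..<k}) {x. inj_on x {..<k}})
      \<rightarrow> {x. inj_on x {..<k}}"
    using e(2) by (auto simp: inj_on_def compose_def PiE_iff)
qed

text \<open>Continuity on a quotient is tested after composing with the quotient map, and there
  \<open>compose_conf_orbit\<close> turns the map on orbits into the map on ordered
  configurations.\<close>

lemma continuous_map_compose_unordered_conf:
  assumes e: "continuous_map X Y e" "inj_on e (topspace X)"
  shows "continuous_map (unordered_conf_space k X) (unordered_conf_space k Y) ((`) (compose {..<k} e))"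
  unfolding unordered_conf_space_def[of k X]
proof (rule continuous_compose_quotient_map[OF quotient_map_quotient_topology])
  have "continuous_map (conf_space k X) (unordered_conf_space k Y) (conf_orbit k \<circ> compose {..<k} e)"
    unfolding unordered_conf_space_def
    by (rule continuous_map_compose[OF continuous_map_compose_conf[OF e]])
      (rule quotient_imp_continuous_map[OF quotient_map_quotient_topology])
  then show "continuous_map (conf_space k X) (unordered_conf_space k Y) ((`) (compose {..<k} e) \<circ> conf_orbit k)"
    by (simp add: o_def compose_conf_orbit)
qed

text \<open>Injectivity keeps points outside \<open>Q\<close> from being sent to a puncture.\<close>

lemma continuous_map_punctured:
  assumes "continuous_map X Y e" "inj_on e (topspace X)" "Q \<subseteq> topspace X"
  shows "continuous_map (punctured X Q) (punctured Y (e ` Q)) e"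
  unfolding punctured_def continuous_map_in_subtopology
proof
  show "continuous_map (subtopology X (topspace X - Q)) Y e"
    using assms(1) by (rule continuous_map_from_subtopology)
  show "e \<in> topspace (subtopology X (topspace X - Q)) \<rightarrow> topspace Y - e ` Q"
    using assms continuous_map_image_subset_topspace[OF assms(1)] by (auto dest: inj_onD)
qed

lemma braid_group_one:
  assumes "x \<in> topspace (conf_space k X)"
  shows "\<one>\<^bsub>braid_group k X x\<^esub> \<in> carrier (braid_group k X x)"
    and "\<one>\<^bsub>braid_group k X x\<^esub> \<otimes>\<^bsub>braid_group k X x\<^esub> \<one>\<^bsub>braid_group k X x\<^esub> = \<one>\<^bsub>braid_group k X x\<^esub>"
  unfolding braid_group_def using fundamental_group_one[OF conf_orbit_in_topspace[OF assms]] by auto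

lemma braid_map_hom:
  assumes "continuous_map X Y e" "inj_on e (topspace X)"
  shows "braid_map k Y e x \<in> hom (braid_group k X x) (braid_group k Y (compose {..<k} e x))"
  using induced_hom_hom[OF continuous_map_compose_unordered_conf[OF assms], of k "conf_orbit k x"]
  by (simp add: braid_map_def braid_group_def compose_conf_orbit)

section \<open>Quotients by the lower central series\<close>

lemma (in group) conj_commutator:
  assumes "x \<in> carrier G" "h \<in> carrier G" "k \<in> carrier G"
  shows "x \<otimes> (h \<otimes> k \<otimes> inv h \<otimes> inv k) \<otimes> inv x
    = (x \<otimes> h \<otimes> inv x) \<otimes> (x \<otimes> k \<otimes> inv x) \<otimes> inv (x \<otimes> h \<otimes> inv x) \<otimes> inv (x \<otimes> k \<otimes> inv x)"
proof -
  have *: "inv x \<otimes> (x \<otimes> y) = y" if "y \<in> carrier G" for y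
    using that assms(1) by (simp flip: m_assoc)
  show ?thesis using assms by (simp add: m_assoc inv_mult_group *)
qed

text \<open>A conjugate of a commutator is the commutator of the conjugates. As \<open>N\<close> is
  normal, the generating set is therefore stable under conjugation.\<close>

lemma (in group) normal_commutator_subgroup:
  assumes "N \<lhd> G"
  shows "commutator_subgroup G (carrier G) N \<lhd> G"
proof -
  interpret N: normal N G by fact
  show ?thesis
    unfolding commutator_subgroup_def
  proof (rule normal_generateI)
    fix h x
    assume "h \<in> {h \<otimes> k \<otimes> inv h \<otimes> inv k |h k. h \<in> carrier G \<and> k \<in> N}" and x: "x \<in> carrier G"
    then obtain y k where h: "h = y \<otimes> k \<otimes> inv y \<otimes> inv k" "y \<in> carrier G" "k \<in> N" by auto
    then have "x \<otimes> h \<otimes> inv x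
        = (x \<otimes> y \<otimes> inv x) \<otimes> (x \<otimes> k \<otimes> inv x) \<otimes> inv (x \<otimes> y \<otimes> inv x) \<otimes> inv (x \<otimes> k \<otimes> inv x)"
      using x by (simp add: conj_commutator N.mem_carrier)
    moreover have "x \<otimes> y \<otimes> inv x \<in> carrier G" "x \<otimes> k \<otimes> inv x \<in> N"
      using h x N.inv_op_closed2 by auto
    ultimately show "x \<otimes> h \<otimes> inv x \<in> {h \<otimes> k \<otimes> inv h \<otimes> inv k |h k. h \<in> carrier G \<and> k \<in> N}"
      by blast
  qed (auto dest: N.mem_carrier)
qed

lemma (in group) lower_central_normal: "lower_central G i \<lhd> G"
proof -
  have "carrier G \<lhd> G" by (rule normal_invI[OF subgroup_self]) simp
  then show ?thesis
    by (induction i rule: induct_nat_012) (auto intro: normal_commutator_subgroup)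
qed

lemma (in group) commutator_in_lower_central:
  assumes "x \<in> carrier G" "y \<in> lower_central G (Suc i)"
  shows "x \<otimes> y \<otimes> inv x \<otimes> inv y \<in> lower_central G (Suc (Suc i))"
  unfolding lower_central.simps commutator_subgroup_def using assms by (intro generate.incl) blast

lemma (in group) commute_iff_commutator:
  assumes "x \<in> carrier G" "y \<in> carrier G"
  shows "x \<otimes> y = y \<otimes> x \<longleftrightarrow> x \<otimes> y \<otimes> inv x \<otimes> inv y = \<one>"
proof -
  have "x \<otimes> y \<otimes> inv x \<otimes> inv y = (x \<otimes> y) \<otimes> inv (y \<otimes> x)"
    using assms by (simp add: inv_mult_group m_assoc)
  then show ?thesis using assms by (metis inv_closed inv_equality inv_inv m_closed r_inv)
qed

lemma (in group_hom) commute_iff: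
  assumes "x \<in> carrier G" "y \<in> carrier G"
  shows "h x \<otimes>\<^bsub>H\<^esub> h y = h y \<otimes>\<^bsub>H\<^esub> h x \<longleftrightarrow> h (x \<otimes> y \<otimes> inv x \<otimes> inv y) = \<one>\<^bsub>H\<^esub>"
  using assms by (simp add: H.commute_iff_commutator)

lemma (in group_hom) trivial_on_generate:
  assumes "S \<subseteq> carrier G" "\<And>x. x \<in> S \<Longrightarrow> h x = \<one>\<^bsub>H\<^esub>" "x \<in> generate G S"
  shows "h x = \<one>\<^bsub>H\<^esub>"
proof -
  have "generate G S \<subseteq> kernel G H h"
    using assms by (intro G.generate_subgroup_incl subgroup_kernel) (auto simp: kernel_def)
  with assms(3) show ?thesis by (auto simp: kernel_def)
qed

lemma (in group_hom) trivial_on_lower_central_2: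
  assumes "\<And>x y. x \<in> carrier G \<Longrightarrow> y \<in> carrier G \<Longrightarrow> h x \<otimes>\<^bsub>H\<^esub> h y = h y \<otimes>\<^bsub>H\<^esub> h x"
    and "x \<in> lower_central G 2"
  shows "h x = \<one>\<^bsub>H\<^esub>"
proof (rule trivial_on_generate)
  show "x \<in> generate G {a \<otimes> b \<otimes> inv a \<otimes> inv b |a b. a \<in> carrier G \<and> b \<in> carrier G}"
    using assms(2) by (simp add: numeral_2_eq_2 commutator_subgroup_def)
  fix y assume "y \<in> {a \<otimes> b \<otimes> inv a \<otimes> inv b |a b. a \<in> carrier G \<and> b \<in> carrier G}"
  then show "h y = \<one>\<^bsub>H\<^esub>" using assms(1) commute_iff by auto
qed auto

text \<open>The elements whose images commute with the whole image of \<open>h\<close> form a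
  subgroup \<open>C\<close>. It contains all commutators, hence \<Gamma>_2, so the generators of
  \<Gamma>_3 become trivial. Commutation is asked only within the image, since \<open>h\<close> need
  not be onto.\<close>

lemma (in group_hom) trivial_on_lower_central_3:
  assumes "\<And>x y z. x \<in> carrier G \<Longrightarrow> y \<in> carrier G \<Longrightarrow> z \<in> carrier G \<Longrightarrow>
      h (x \<otimes> y \<otimes> inv x \<otimes> inv y) \<otimes>\<^bsub>H\<^esub> h z = h z \<otimes>\<^bsub>H\<^esub> h (x \<otimes> y \<otimes> inv x \<otimes> inv y)"
    and "x \<in> lower_central G 3"
  shows "h x = \<one>\<^bsub>H\<^esub>"
proof -
  let ?\<Gamma>2 = "lower_central G (Suc (Suc 0))"
  interpret \<Gamma>2: normal ?\<Gamma>2 G by (rule G.lower_central_normal)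
  define C where "C = {c \<in> carrier G. \<forall>z\<in>carrier G. h c \<otimes>\<^bsub>H\<^esub> h z = h z \<otimes>\<^bsub>H\<^esub> h c}"
  have "subgroup C G"
  proof (rule G.subgroupI)
    show "inv c \<in> C" if "c \<in> C" for c
    proof -
      have c: "c \<in> carrier G" and comm: "\<And>z. z \<in> carrier G \<Longrightarrow> h c \<otimes>\<^bsub>H\<^esub> h z = h z \<otimes>\<^bsub>H\<^esub> h c"
        using that by (auto simp: C_def)
      have "inv\<^bsub>H\<^esub> h c \<otimes>\<^bsub>H\<^esub> h z = h z \<otimes>\<^bsub>H\<^esub> inv\<^bsub>H\<^esub> h c" if z: "z \<in> carrier G" for z
      proof -
        have "h z = h c \<otimes>\<^bsub>H\<^esub> (h z \<otimes>\<^bsub>H\<^esub> inv\<^bsub>H\<^esub> h c)"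
          using c z comm[OF z] by (simp flip: H.m_assoc) (simp add: H.m_assoc)
        then show ?thesis using c z by (simp add: H.inv_solve_left')
      qed
      then show ?thesis using c by (simp add: C_def)
    qed
    show "c \<otimes> d \<in> C" if "c \<in> C" "d \<in> C" for c d
    proof -
      have cd: "c \<in> carrier G" "d \<in> carrier G"
        and comm: "\<And>z. z \<in> carrier G \<Longrightarrow> h c \<otimes>\<^bsub>H\<^esub> h z = h z \<otimes>\<^bsub>H\<^esub> h c"
          "\<And>z. z \<in> carrier G \<Longrightarrow> h d \<otimes>\<^bsub>H\<^esub> h z = h z \<otimes>\<^bsub>H\<^esub> h d"
        using that by (auto simp: C_def)
      have "h c \<otimes>\<^bsub>H\<^esub> h d \<otimes>\<^bsub>H\<^esub> h z = h z \<otimes>\<^bsub>H\<^esub> (h c \<otimes>\<^bsub>H\<^esub> h d)" if z: "z \<in> carrier G" for z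
      proof -
        have "h c \<otimes>\<^bsub>H\<^esub> h d \<otimes>\<^bsub>H\<^esub> h z = h c \<otimes>\<^bsub>H\<^esub> h z \<otimes>\<^bsub>H\<^esub> h d"
          using cd z by (simp add: H.m_assoc comm(2))
        then show ?thesis using cd z by (simp add: comm(1) H.m_assoc)
      qed
      then show ?thesis using cd by (simp add: C_def)
    qed
    show "C \<noteq> {}" using G.one_closed unfolding C_def by force
  qed (simp add: C_def)
  then have "?\<Gamma>2 \<subseteq> C"
    using assms(1) unfolding lower_central.simps commutator_subgroup_def
    by (intro G.generate_subgroup_incl) (auto simp: C_def simp del: hom_mult)
  then have *: "h z \<otimes>\<^bsub>H\<^esub> h c = h c \<otimes>\<^bsub>H\<^esub> h z" if "z \<in> carrier G" "c \<in> ?\<Gamma>2" for z c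
    using that by (auto simp: C_def)
  show ?thesis
  proof (rule trivial_on_generate)
    \<comment> \<open>Only the outer commutator subgroup is unfolded; the inner one stays folded as
      the second term of the series.\<close>
    show "x \<in> generate G {a \<otimes> b \<otimes> inv a \<otimes> inv b |a b. a \<in> carrier G \<and> b \<in> ?\<Gamma>2}"
      using assms(2) by (simp add: numeral_3_eq_3 commutator_subgroup_def[of G "carrier G" "commutator_subgroup _ _ _"])
    fix y assume "y \<in> {a \<otimes> b \<otimes> inv a \<otimes> inv b |a b. a \<in> carrier G \<and> b \<in> ?\<Gamma>2}"
    then show "h y = \<one>\<^bsub>H\<^esub>" using * commute_iff \<Gamma>2.mem_carrier by auto
  qed (use \<Gamma>2.mem_carrier in blast)
qed

section \<open>Factoring homomorphisms through quotients\<close>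

lemma (in normal) coset_group_hom: "group_hom G (G Mod H) (\<lambda>x. H #> x)"
  using factorgroup_is_group r_coset_hom_Mod
  by (simp add: group_hom_def group_hom_axioms_def is_group)

lemma (in normal) coset_eq_one_iff:
  assumes "x \<in> carrier G"
  shows "H #> x = \<one>\<^bsub>G Mod H\<^esub> \<longleftrightarrow> x \<in> H"
  unfolding one_FactGroup using assms coset_join1 coset_join2 subgroup_axioms by blast

lemma (in group_hom) eq_iff_ker:
  assumes "x \<in> carrier G" "y \<in> carrier G"
  shows "h x = h y \<longleftrightarrow> h (x \<otimes> inv y) = \<one>\<^bsub>H\<^esub>"
  using assms by (simp add: H.inv_solve_right')

lemma (in normal) hom_factors:
  assumes "group K" "f \<in> hom G K" "\<And>x. x \<in> H \<Longrightarrow> f x = \<one>\<^bsub>K\<^esub>"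
  obtains f' where "f' \<in> hom (G Mod H) K" "\<And>x. x \<in> carrier G \<Longrightarrow> f' (H #> x) = f x"
proof -
  interpret f: group_hom G K f using assms by (simp add: group_hom_def group_hom_axioms_def is_group)
  interpret c: group_hom G "G Mod H" "\<lambda>x. H #> x" by (rule coset_group_hom)
  have "f x = f y" if xy: "x \<in> carrier G" "y \<in> carrier G" and eq: "H #> x = H #> y" for x y
  proof -
    have "x \<otimes> inv y \<in> H"
      using eq c.eq_iff_ker[OF xy] coset_eq_one_iff[of "x \<otimes> inv y"] xy by blast
    then show ?thesis using f.eq_iff_ker[OF xy] assms(3) by blast
  qed
  then show thesis
    using FactGroup_universal[OF assms(2) normal_axioms] that by metis
qed

lemma (in normal) factors_through_quotient_iff:
  assumes "group K" "f \<in> hom G K"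
  shows "factors_through_quotient G H K f \<longleftrightarrow> (\<forall>x\<in>H. f x = \<one>\<^bsub>K\<^esub>)"
proof
  assume "factors_through_quotient G H K f"
  then obtain f' where f': "f' \<in> hom (G Mod H) K" "\<forall>x\<in>carrier G. f x = f' (H #> x)"
    by (auto simp: factors_through_quotient_def)
  then show "\<forall>x\<in>H. f x = \<one>\<^bsub>K\<^esub>"
    using hom_one[OF f'(1) factorgroup_is_group assms(1)] coset_eq_one_iff mem_carrier by metis
next
  assume "\<forall>x\<in>H. f x = \<one>\<^bsub>K\<^esub>"
  then obtain f' where "f' \<in> hom (G Mod H) K" "\<And>x. x \<in> carrier G \<Longrightarrow> f' (H #> x) = f x"
    using hom_factors[OF assms] by blast
  then show "factors_through_quotient G H K f"
    unfolding factors_through_quotient_def by (intro bexI[of _ f'] ballI) simp_all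
qed

text \<open>The braid relation says that \<open>u = s t\<close> conjugates \<open>s\<close> to
  \<open>t\<close>, so \<open>t = c s\<close> for the commutator \<open>c\<close> of
  \<open>u\<close> and \<open>s\<close>. As \<open>c\<close> is central,
  \<open>s t s = c s^3\<close> and \<open>t s t = c^2 s^3\<close>, whence \<open>c\<close> is
  trivial.\<close>

lemma (in group) braid_relation_collapse:
  assumes st: "s \<in> carrier G" "t \<in> carrier G" and braid: "s \<otimes> t \<otimes> s = t \<otimes> s \<otimes> t"
    and central: "\<And>x y z. x \<in> carrier G \<Longrightarrow> y \<in> carrier G \<Longrightarrow> z \<in> carrier G \<Longrightarrow>
      (x \<otimes> y \<otimes> inv x \<otimes> inv y) \<otimes> z = z \<otimes> (x \<otimes> y \<otimes> inv x \<otimes> inv y)"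
  shows "s = t"
proof -
  define u where "u = s \<otimes> t"
  have u: "u \<in> carrier G" using st by (simp add: u_def)
  have "u \<otimes> s = t \<otimes> u" using braid st by (simp add: u_def m_assoc)
  then have t: "u \<otimes> s \<otimes> inv u = t" using u st by (simp add: m_assoc)
  define c where "c = u \<otimes> s \<otimes> inv u \<otimes> inv s"
  have c: "c \<in> carrier G" "t = c \<otimes> s" using u st t by (simp_all add: c_def m_assoc)
  have cz: "c \<otimes> z = z \<otimes> c" if "z \<in> carrier G" for z
    unfolding c_def using central[OF u st(1) that] .
  have scs: "s \<otimes> (c \<otimes> y) = c \<otimes> (s \<otimes> y)" if "y \<in> carrier G" for y
    using c(1) st(1) that cz[OF st(1)] by (metis m_assoc)
  have "s \<otimes> t \<otimes> s = c \<otimes> (s \<otimes> s \<otimes> s)"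
    unfolding c(2) using c(1) st(1) by (simp add: m_assoc scs)
  moreover have "t \<otimes> s \<otimes> t = c \<otimes> (c \<otimes> (s \<otimes> s \<otimes> s))"
    unfolding c(2) using c(1) st(1) by (simp add: m_assoc scs)
  ultimately have "c \<otimes> (s \<otimes> s \<otimes> s) = s \<otimes> s \<otimes> s" using braid c st by simp
  then have "c = \<one>" using c(1) st(1) by (simp add: r_cancel_one)
  then show "s = t" using c st by simp
qed

section \<open>Representations identifying all the \<open>\<sigma>\<^sub>i\<close>\<close>

text \<open>Since \<open>k \<ge> 3\<close>, the common value \<open>s\<close> of the \<open>\<sigma>\<^sub>i\<close> is also the value of \<open>\<sigma>\<^sub>2\<close>, which
  commutes with all \<open>a\<^sub>i\<close>, \<open>b\<^sub>i\<close>, \<open>\<zeta>\<^sub>i\<close>; this makes \<open>s\<close> central and trivializes the conjugations by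
  \<open>\<sigma>\<^sub>1\<close> in the relations.\<close>

locale braid_rep =
  B: presented B \<gamma> "braid_gens k g n" "braid_rels k g n" + group_hom B G f
  for B :: "('b, 'm) monoid_scheme" (structure) and \<gamma> k g n and G :: "('c, 'l) monoid_scheme" and f +
  fixes s
  assumes k: "3 \<le> k" and f_sigma: "\<And>i. 1 \<le> i \<Longrightarrow> i < k \<Longrightarrow> f (\<gamma> (Sig i)) = s"
begin

abbreviation F where "F \<equiv> \<lambda>u. f (\<gamma> u)"

lemma F_closed [simp]: "u \<in> braid_gens k g n \<Longrightarrow> F u \<in> carrier G"
  by simp

lemma Sig_gens [simp]: "1 \<le> i \<Longrightarrow> i < k \<Longrightarrow> Sig i \<in> braid_gens k g n"
  by (auto simp: braid_gens_def S_gens_def)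

lemma Sig_1 [simp]: "Sig (Suc 0) \<in> S_gens k" "Sig (Suc 0) \<in> braid_gens k g n" "F (Sig (Suc 0)) = s"
  using k f_sigma[of 1] by (auto simp: braid_gens_def S_gens_def)

lemma AB_Z_gens [simp]: "u \<in> AB_gens g \<Longrightarrow> u \<in> braid_gens k g n" "u \<in> Z_gens n \<Longrightarrow> u \<in> braid_gens k g n"
  by (auto simp: braid_gens_def)

lemma s_closed [simp]: "s \<in> carrier G"
  using F_closed[of "Sig 1"] by simp

lemma F_relation:
  assumes "(l, r) \<in> braid_rels k g n" "l \<in> words (braid_gens k g n)" "r \<in> words (braid_gens k g n)"
  shows "word_eval G (f \<circ> \<gamma>) l = word_eval G (f \<circ> \<gamma>) r"
  using B.hom_relation[OF H.group_axioms homh assms] .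

section \<open>Commutation relations between the images of the generators\<close>

lemma s_commute_local:
  assumes "c \<in> AB_gens g \<union> Z_gens n"
  shows "F c \<otimes>\<^bsub>G\<^esub> s = s \<otimes>\<^bsub>G\<^esub> F c"
proof -
  have 2: "Sig 2 \<in> S_gens k" "F (Sig 2) = s" "Sig 2 \<in> braid_gens k g n"
    using k f_sigma by (auto simp: S_gens_def)
  have c: "c \<in> braid_gens k g n" using assms by auto
  show ?thesis using F_relation[OF braid_rels.local[OF assms 2(1)]] c 2 by simp
qed

lemma s_commute:
  assumes "u \<in> braid_gens k g n"
  shows "F u \<otimes>\<^bsub>G\<^esub> s = s \<otimes>\<^bsub>G\<^esub> F u"
  using assms s_commute_local f_sigma by (auto simp: braid_gens_def S_gens_def)

lemma s_left_commute:
  assumes "u \<in> braid_gens k g n" "y \<in> carrier G"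
  shows "F u \<otimes>\<^bsub>G\<^esub> (s \<otimes>\<^bsub>G\<^esub> y) = s \<otimes>\<^bsub>G\<^esub> (F u \<otimes>\<^bsub>G\<^esub> y)"
  using assms s_commute[OF assms(1)] by (simp flip: H.m_assoc)

lemma s_cancel: "y \<in> carrier G \<Longrightarrow> inv\<^bsub>G\<^esub> s \<otimes>\<^bsub>G\<^esub> (s \<otimes>\<^bsub>G\<^esub> y) = y"
  by (simp flip: H.m_assoc)

lemma F_commute_of_relation:
  assumes "u \<in> braid_gens k g n" "v \<in> braid_gens k g n"
    and "([Neg (Sig 1), Pos u, Pos (Sig 1), Pos v], [Pos v, Neg (Sig 1), Pos u, Pos (Sig 1)])
      \<in> braid_rels k g n"
  shows "F u \<otimes>\<^bsub>G\<^esub> F v = F v \<otimes>\<^bsub>G\<^esub> F u"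
  using F_relation[OF assms(3)] assms(1,2)
  by (simp add: s_left_commute s_commute s_cancel)

lemma F_Zeta_AB:
  assumes "u \<in> Z_gens n" "v \<in> AB_gens g"
  shows "F u \<otimes>\<^bsub>G\<^esub> F v = F v \<otimes>\<^bsub>G\<^esub> F u"
proof -
  obtain i where "u = Zeta i" using assms by (auto simp: Z_gens_def)
  then show ?thesis
    using assms by (intro F_commute_of_relation) (simp_all add: braid_rels.puncture_handle[simplified])
qed

lemma F_Zeta_Zeta:
  assumes "u \<in> Z_gens n" "v \<in> Z_gens n"
  shows "F u \<otimes>\<^bsub>G\<^esub> F v = F v \<otimes>\<^bsub>G\<^esub> F u"
proof -
  have *: "F (Zeta i) \<otimes>\<^bsub>G\<^esub> F (Zeta j) = F (Zeta j) \<otimes>\<^bsub>G\<^esub> F (Zeta i)"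
    if "Zeta i \<in> Z_gens n" "Zeta j \<in> Z_gens n" "i < j" for i j
    using that by (intro F_commute_of_relation) (simp_all add: braid_rels.punctures[simplified])
  obtain i j where "u = Zeta i" "v = Zeta j" using assms by (auto simp: Z_gens_def)
  then show ?thesis using assms *[of i j] *[of j i] by (cases i j rule: linorder_cases) auto
qed

text \<open>Once \<open>s\<close> is central, the handle relation has one \<open>s\<close> on the
  left and three on the right; cancelling one leaves the square.\<close>

lemma F_handle:
  assumes "1 \<le> i" "i \<le> g"
  shows "F (Aa i) \<otimes>\<^bsub>G\<^esub> F (Bb i) = s \<otimes>\<^bsub>G\<^esub> s \<otimes>\<^bsub>G\<^esub> (F (Bb i) \<otimes>\<^bsub>G\<^esub> F (Aa i))"
proof -
  have u: "Aa i \<in> braid_gens k g n" "Bb i \<in> braid_gens k g n"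
    using assms by (auto simp: braid_gens_def AB_gens_def)
  then show ?thesis
    using F_relation[OF braid_rels.handle[OF assms]]
    by (simp add: s_left_commute s_commute H.m_assoc)
qed

lemma F_AB_AB:
  assumes u: "u \<in> AB_gens g" and v: "v \<in> AB_gens g"
    and "\<And>i. {u, v} \<noteq> {Aa i, Bb i}"
  shows "F u \<otimes>\<^bsub>G\<^esub> F v = F v \<otimes>\<^bsub>G\<^esub> F u"
proof -
  obtain i where i: "u \<in> {Aa i, Bb i}" "1 \<le> i" "i \<le> g" using u by (auto simp: AB_gens_def)
  obtain j where j: "v \<in> {Aa j, Bb j}" "1 \<le> j" "j \<le> g" using v by (auto simp: AB_gens_def)
  \<comment> \<open>Equal indices leave only \<open>u = v\<close>, because the two generators of one
    handle are excluded.\<close>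
  consider "AB_less g u v" | "AB_less g v u" | "u = v"
    using i j assms(3)[of i] by (cases i j rule: linorder_cases) (auto simp: AB_less_def)
  then show ?thesis
  proof cases
    case 1
    then show ?thesis using u v by (intro F_commute_of_relation) (simp_all add: braid_rels.handles[simplified])
  next
    case 2
    then show ?thesis using u v
      by (intro F_commute_of_relation[symmetric]) (simp_all add: braid_rels.handles[simplified])
  qed simp
qed

text \<open>This is the centralizer in \<open>G\<close> of the image of \<open>f\<close>. As
  \<open>G\<close> may be larger than that image, it need not be the centre of
  \<open>G\<close>.\<close>

definition central :: "'c set" where
  "central = {z \<in> carrier G. \<forall>b\<in>carrier B. z \<otimes>\<^bsub>G\<^esub> f b = f b \<otimes>\<^bsub>G\<^esub> z}"

lemma centralI:
  assumes "z \<in> carrier G" "\<And>u. u \<in> braid_gens k g n \<Longrightarrow> z \<otimes>\<^bsub>G\<^esub> F u = F u \<otimes>\<^bsub>G\<^esub> z"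
  shows "z \<in> central"
proof -
  have "z \<otimes>\<^bsub>G\<^esub> f b = f b \<otimes>\<^bsub>G\<^esub> z" if "b \<in> carrier B" for b
    using that
  proof (induction b rule: B.gen_induct)
    case (inv b)
    then have "z = f b \<otimes>\<^bsub>G\<^esub> (z \<otimes>\<^bsub>G\<^esub> inv\<^bsub>G\<^esub> f b)"
      using assms(1) by (simp flip: H.m_assoc) (simp flip: inv.IH add: H.m_assoc)
    then show ?case
      using inv.hyps assms(1) by (simp add: H.inv_solve_left)
  next
    case (mult b c)
    have "z \<otimes>\<^bsub>G\<^esub> (f b \<otimes>\<^bsub>G\<^esub> f c) = f b \<otimes>\<^bsub>G\<^esub> (z \<otimes>\<^bsub>G\<^esub> f c)"
      using mult.hyps mult.IH(1) assms(1) by (simp flip: H.m_assoc)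
    then show ?case using mult assms(1) by (simp add: H.m_assoc)
  qed (use assms in simp_all)
  then show ?thesis using assms(1) by (simp add: central_def)
qed

lemma central_closed: "z \<in> central \<Longrightarrow> z \<in> carrier G"
  by (simp add: central_def)

lemma central_commute: "z \<in> central \<Longrightarrow> b \<in> carrier B \<Longrightarrow> z \<otimes>\<^bsub>G\<^esub> f b = f b \<otimes>\<^bsub>G\<^esub> z"
  by (simp add: central_def)

lemma s_central: "s \<in> central"
  by (rule centralI) (simp_all add: s_commute)

lemma Zeta_central: "u \<in> Z_gens n \<Longrightarrow> F u \<in> central"
proof (rule centralI)
  fix v assume "u \<in> Z_gens n" "v \<in> braid_gens k g n"
  then show "F u \<otimes>\<^bsub>G\<^esub> F v = F v \<otimes>\<^bsub>G\<^esub> F u"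
    using F_Zeta_AB F_Zeta_Zeta s_commute[of u] f_sigma by (auto simp: braid_gens_def S_gens_def)
qed simp

lemma subgroup_central: "subgroup central G"
proof (rule H.subgroupI)
  show "central \<subseteq> carrier G" by (auto simp: central_def)
  show "central \<noteq> {}" using s_central by blast
  show "inv\<^bsub>G\<^esub> z \<in> central" if z: "z \<in> central" for z
  proof (rule centralI)
    fix u assume u: "u \<in> braid_gens k g n"
    have "F u = z \<otimes>\<^bsub>G\<^esub> (F u \<otimes>\<^bsub>G\<^esub> inv\<^bsub>G\<^esub> z)"
      using u central_closed[OF z] central_commute[OF z, of "\<gamma> u"]
      by (simp flip: H.m_assoc) (simp add: H.m_assoc)
    then show "inv\<^bsub>G\<^esub> z \<otimes>\<^bsub>G\<^esub> F u = F u \<otimes>\<^bsub>G\<^esub> inv\<^bsub>G\<^esub> z"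
      using u central_closed[OF z] by (simp add: H.inv_solve_left')
  qed (use central_closed[OF z] in simp)
  show "z \<otimes>\<^bsub>G\<^esub> w \<in> central" if z: "z \<in> central" and w: "w \<in> central" for z w
  proof (rule centralI)
    fix u assume u: "u \<in> braid_gens k g n"
    have "z \<otimes>\<^bsub>G\<^esub> w \<otimes>\<^bsub>G\<^esub> F u = z \<otimes>\<^bsub>G\<^esub> F u \<otimes>\<^bsub>G\<^esub> w"
      using u central_closed[OF z] central_closed[OF w] central_commute[OF w, of "\<gamma> u"]
      by (simp add: H.m_assoc)
    then show "z \<otimes>\<^bsub>G\<^esub> w \<otimes>\<^bsub>G\<^esub> F u = F u \<otimes>\<^bsub>G\<^esub> (z \<otimes>\<^bsub>G\<^esub> w)"
      using u central_closed[OF z] central_closed[OF w] central_commute[OF z, of "\<gamma> u"]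
      by (simp add: H.m_assoc)
  qed (use central_closed z w in simp)
qed

text \<open>Only the two generators of one handle can fail to commute. The square of
  \<open>s\<close> occurs for the order \<open>a_i\<close>, \<open>b_i\<close>, its inverse for the
  opposite order.\<close>

lemma F_commute_up_to_s:
  assumes "u \<in> braid_gens k g n" "v \<in> braid_gens k g n"
  obtains z where "z \<in> {\<one>\<^bsub>G\<^esub>, s \<otimes>\<^bsub>G\<^esub> s, inv\<^bsub>G\<^esub> (s \<otimes>\<^bsub>G\<^esub> s)}"
    "F u \<otimes>\<^bsub>G\<^esub> F v = z \<otimes>\<^bsub>G\<^esub> (F v \<otimes>\<^bsub>G\<^esub> F u)"
proof -
  consider "F u \<in> central" | "F v \<in> central" | "u \<in> AB_gens g" "v \<in> AB_gens g"
    using assms Zeta_central s_central f_sigma by (auto simp: braid_gens_def S_gens_def)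
  then consider "F u \<otimes>\<^bsub>G\<^esub> F v = F v \<otimes>\<^bsub>G\<^esub> F u"
    | i where "1 \<le> i" "i \<le> g" "u = Aa i" "v = Bb i" | i where "1 \<le> i" "i \<le> g" "u = Bb i" "v = Aa i"
  proof cases
    case 1
    then show ?thesis using that(1) central_commute assms by simp
  next
    case 2
    then show ?thesis using that(1) central_commute[of "F v" "\<gamma> u"] assms by simp
  next
    case 3
    show ?thesis
    proof (cases "\<exists>i. {u, v} = {Aa i, Bb i}")
      case True
      then show ?thesis using 3 that(2,3) by (auto simp: AB_gens_def doubleton_eq_iff)
    next
      case False
      then show ?thesis using 3 F_AB_AB that(1) by blast
    qed
  qed
  then show thesis
  proof cases
    case 1
    then show ?thesis using that[of "\<one>\<^bsub>G\<^esub>"] assms by simp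
  next
    case 2
    then show ?thesis using that[of "s \<otimes>\<^bsub>G\<^esub> s"] F_handle by simp
  next
    case 3
    have "F u \<otimes>\<^bsub>G\<^esub> F v = inv\<^bsub>G\<^esub> (s \<otimes>\<^bsub>G\<^esub> s) \<otimes>\<^bsub>G\<^esub> (F v \<otimes>\<^bsub>G\<^esub> F u)"
      using 3 assms F_handle[of i] by (simp add: H.inv_solve_left)
    then show ?thesis using that by blast
  qed
qed

text \<open>Because \<open>Z\<close> consists of elements commuting with the whole image, the
  corrections can be collected in front while words are built up. Taking \<open>Z\<close> to be
  \<open>central\<close> gives class at most 2, and the trivial subgroup gives
  commutativity.\<close>

lemma commute_up_to:
  assumes Z: "subgroup Z G" "Z \<subseteq> central"
    and gens: "\<And>u v. u \<in> braid_gens k g n \<Longrightarrow> v \<in> braid_gens k g n \<Longrightarrow>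
      \<exists>z\<in>Z. F u \<otimes>\<^bsub>G\<^esub> F v = z \<otimes>\<^bsub>G\<^esub> (F v \<otimes>\<^bsub>G\<^esub> F u)"
    and b: "b \<in> carrier B" and c: "c \<in> carrier B"
  shows "\<exists>z\<in>Z. f b \<otimes>\<^bsub>G\<^esub> f c = z \<otimes>\<^bsub>G\<^esub> (f c \<otimes>\<^bsub>G\<^esub> f b)"
proof -
  interpret Z: subgroup Z G by fact
  note Zc = subsetD[OF Z(2)]
  define P where "P b c \<longleftrightarrow> (\<exists>z\<in>Z. f b \<otimes>\<^bsub>G\<^esub> f c = z \<otimes>\<^bsub>G\<^esub> (f c \<otimes>\<^bsub>G\<^esub> f b))" for b c
  \<comment> \<open>Swapping the arguments inverts the correction. This lets the induction on the
    first argument also serve for the second.\<close>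
  have sym: "P c b" if P: "P b c" and "b \<in> carrier B" "c \<in> carrier B" for b c
  proof -
    obtain z where z: "z \<in> Z" "f b \<otimes>\<^bsub>G\<^esub> f c = z \<otimes>\<^bsub>G\<^esub> (f c \<otimes>\<^bsub>G\<^esub> f b)"
      using P unfolding P_def by blast
    then have "f c \<otimes>\<^bsub>G\<^esub> f b = inv\<^bsub>G\<^esub> z \<otimes>\<^bsub>G\<^esub> (f b \<otimes>\<^bsub>G\<^esub> f c)"
      using that z(1) by (intro H.inv_solve_left[THEN iffD2, OF _ _ _ z(2)]) simp_all
    then show ?thesis using Z.m_inv_closed[OF z(1)] unfolding P_def by blast
  qed
  have left: "P b c" if "b \<in> carrier B" "c \<in> carrier B" "\<And>u. u \<in> braid_gens k g n \<Longrightarrow> P (\<gamma> u) c" for b c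
    using that(1)
  proof (induction b rule: B.gen_induct)
    case one
    show ?case unfolding P_def using that(2) by (intro bexI[of _ "\<one>\<^bsub>G\<^esub>"]) auto
  next
    case (inv b)
    from inv.IH obtain z where z: "z \<in> Z" "f b \<otimes>\<^bsub>G\<^esub> f c = z \<otimes>\<^bsub>G\<^esub> (f c \<otimes>\<^bsub>G\<^esub> f b)"
      unfolding P_def by blast
    have "f c = f c \<otimes>\<^bsub>G\<^esub> f b \<otimes>\<^bsub>G\<^esub> inv\<^bsub>G\<^esub> f b" using inv that(2) by (simp add: H.m_assoc)
    also have "f c \<otimes>\<^bsub>G\<^esub> f b = inv\<^bsub>G\<^esub> z \<otimes>\<^bsub>G\<^esub> (f b \<otimes>\<^bsub>G\<^esub> f c)"
      using z(1) inv.hyps that(2) by (intro H.inv_solve_left[THEN iffD2, OF _ _ _ z(2)]) simp_all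
    also have "\<dots> \<otimes>\<^bsub>G\<^esub> inv\<^bsub>G\<^esub> f b = f b \<otimes>\<^bsub>G\<^esub> (inv\<^bsub>G\<^esub> z \<otimes>\<^bsub>G\<^esub> (f c \<otimes>\<^bsub>G\<^esub> inv\<^bsub>G\<^esub> f b))"
      using inv that(2) z(1) central_commute[OF Zc[OF Z.m_inv_closed[OF z(1)]], of b]
      by (simp flip: H.m_assoc)
    finally have "inv\<^bsub>G\<^esub> f b \<otimes>\<^bsub>G\<^esub> f c = inv\<^bsub>G\<^esub> z \<otimes>\<^bsub>G\<^esub> (f c \<otimes>\<^bsub>G\<^esub> inv\<^bsub>G\<^esub> f b)"
      using inv that(2) z(1) by (simp add: H.inv_solve_left')
    then show ?case
      unfolding P_def using inv.hyps z(1) by (intro bexI[of _ "inv\<^bsub>G\<^esub> z"]) simp_all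
  next
    case (gen u)
    then show ?case by (rule that(3))
  next
    case (mult b b')
    then obtain z z' where z: "z \<in> Z" "f b \<otimes>\<^bsub>G\<^esub> f c = z \<otimes>\<^bsub>G\<^esub> (f c \<otimes>\<^bsub>G\<^esub> f b)"
      and z': "z' \<in> Z" "f b' \<otimes>\<^bsub>G\<^esub> f c = z' \<otimes>\<^bsub>G\<^esub> (f c \<otimes>\<^bsub>G\<^esub> f b')" unfolding P_def by blast
    have "f b \<otimes>\<^bsub>G\<^esub> f b' \<otimes>\<^bsub>G\<^esub> f c = f b \<otimes>\<^bsub>G\<^esub> z' \<otimes>\<^bsub>G\<^esub> (f c \<otimes>\<^bsub>G\<^esub> f b')"
      using mult that(2) z' by (simp add: H.m_assoc)
    also have "\<dots> = z' \<otimes>\<^bsub>G\<^esub> (f b \<otimes>\<^bsub>G\<^esub> f c) \<otimes>\<^bsub>G\<^esub> f b'"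
      using mult that(2) z'(1) by (simp add: H.m_assoc flip: central_commute[OF Zc[OF z'(1)]])
    also have "\<dots> = (z' \<otimes>\<^bsub>G\<^esub> z) \<otimes>\<^bsub>G\<^esub> (f c \<otimes>\<^bsub>G\<^esub> (f b \<otimes>\<^bsub>G\<^esub> f b'))"
      unfolding z(2) using mult.hyps that(2) z(1) z'(1) by (simp add: H.m_assoc)
    finally show ?case
      using mult(1,2) z(1) z'(1) unfolding P_def by (intro bexI[of _ "z' \<otimes>\<^bsub>G\<^esub> z"]) auto
  qed
  have "P (\<gamma> u) c" if "u \<in> braid_gens k g n" for u
  proof (rule sym)
    show "P c (\<gamma> u)"
      by (rule left) (use that c gens in \<open>simp_all add: P_def\<close>)
  qed (use that c in simp_all)
  then have "P b c" by (rule left[OF b c])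
  then show ?thesis by (simp add: P_def)
qed

lemma commutator_central:
  assumes "b \<in> carrier B" "c \<in> carrier B"
  shows "f (b \<otimes> c \<otimes> inv b \<otimes> inv c) \<in> central"
proof -
  interpret Z: subgroup central G by (rule subgroup_central)
  have "\<exists>z\<in>central. f b \<otimes>\<^bsub>G\<^esub> f c = z \<otimes>\<^bsub>G\<^esub> (f c \<otimes>\<^bsub>G\<^esub> f b)"
  proof (rule commute_up_to[OF subgroup_central _ _ assms])
    fix u v assume "u \<in> braid_gens k g n" "v \<in> braid_gens k g n"
    then obtain z where "z \<in> {\<one>\<^bsub>G\<^esub>, s \<otimes>\<^bsub>G\<^esub> s, inv\<^bsub>G\<^esub> (s \<otimes>\<^bsub>G\<^esub> s)}"
      "F u \<otimes>\<^bsub>G\<^esub> F v = z \<otimes>\<^bsub>G\<^esub> (F v \<otimes>\<^bsub>G\<^esub> F u)" by (rule F_commute_up_to_s)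
    then show "\<exists>z\<in>central. F u \<otimes>\<^bsub>G\<^esub> F v = z \<otimes>\<^bsub>G\<^esub> (F v \<otimes>\<^bsub>G\<^esub> F u)"
      using s_central Z.one_closed Z.m_closed Z.m_inv_closed by blast
  qed simp
  then obtain z where z: "z \<in> central" "f b \<otimes>\<^bsub>G\<^esub> f c = z \<otimes>\<^bsub>G\<^esub> (f c \<otimes>\<^bsub>G\<^esub> f b)" by blast
  have "f (b \<otimes> c \<otimes> inv b \<otimes> inv c) = (f b \<otimes>\<^bsub>G\<^esub> f c) \<otimes>\<^bsub>G\<^esub> inv\<^bsub>G\<^esub> (f c \<otimes>\<^bsub>G\<^esub> f b)"
    using assms by (simp add: H.inv_mult_group H.m_assoc)
  also have "\<dots> = z" unfolding z(2) using assms z(1) by (simp add: H.m_assoc)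
  finally show ?thesis using z(1) by simp
qed

lemma trivial_on_Gamma3: "b \<in> lower_central B 3 \<Longrightarrow> f b = \<one>\<^bsub>G\<^esub>"
  by (rule trivial_on_lower_central_3)
    (use central_commute[OF commutator_central] in \<open>simp_all del: hom_mult hom_inv\<close>)

lemma commute_if_s_square_trivial:
  assumes "s \<otimes>\<^bsub>G\<^esub> s = \<one>\<^bsub>G\<^esub>" "b \<in> carrier B" "c \<in> carrier B"
  shows "f b \<otimes>\<^bsub>G\<^esub> f c = f c \<otimes>\<^bsub>G\<^esub> f b"
proof -
  have "\<exists>z\<in>{\<one>\<^bsub>G\<^esub>}. f b \<otimes>\<^bsub>G\<^esub> f c = z \<otimes>\<^bsub>G\<^esub> (f c \<otimes>\<^bsub>G\<^esub> f b)"
  proof (rule commute_up_to[OF H.triv_subgroup _ _ assms(2,3)])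
    show "{\<one>\<^bsub>G\<^esub>} \<subseteq> central" using subgroup.one_closed[OF subgroup_central] by simp
    fix u v assume "u \<in> braid_gens k g n" "v \<in> braid_gens k g n"
    then show "\<exists>z\<in>{\<one>\<^bsub>G\<^esub>}. F u \<otimes>\<^bsub>G\<^esub> F v = z \<otimes>\<^bsub>G\<^esub> (F v \<otimes>\<^bsub>G\<^esub> F u)"
      using F_commute_up_to_s[of u v] assms(1) by force
  qed
  then show ?thesis using assms by simp
qed

end

section \<open>Detecting exponents\<close>

text \<open>Both sides are homomorphisms in \<open>b\<close> to an abelian group and agree on
  generators. Here \<open>\<psi> b u\<close> is the exponent with which the class \<open>c u\<close>
  occurs. Several generators may share a class, as the \<sigma>_i do in
  \<open>D Mod \<Gamma>2\<close>, and some may die, as those of the disc do in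
  \<open>B Mod K\<close>. The use is always the same: if all exponents vanish, then
  \<open>q b\<close> is trivial.\<close>

lemma (in presented) comm_hom_eval:
  assumes A: "comm_group A" and q: "q \<in> hom B A" and U: "finite U" "c \<in> U \<rightarrow> carrier A"
    and add: "\<And>b b' u. b \<in> carrier B \<Longrightarrow> b' \<in> carrier B \<Longrightarrow> u \<in> U \<Longrightarrow> \<psi> (b \<otimes> b') u = \<psi> b u + \<psi> b' u"
    and gen: "\<And>x. x \<in> X \<Longrightarrow> q (gen x) = \<one>\<^bsub>A\<^esub> \<and> (\<forall>u\<in>U. \<psi> (gen x) u = 0)
        \<or> (\<exists>w\<in>U. q (gen x) = c w \<and> (\<forall>u\<in>U. \<psi> (gen x) u = (if u = w then 1 else 0)))"
    and b: "b \<in> carrier B"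
  shows "q b = finprod A (\<lambda>u. c u [^]\<^bsub>A\<^esub> (\<psi> b u :: int)) U"
proof -
  interpret A: comm_group A by fact
  interpret q: group_hom B A q using q by unfold_locales
  have c [simp]: "c u \<in> carrier A" if "u \<in> U" for u using that U by auto
  let ?P = "\<lambda>b. finprod A (\<lambda>u. c u [^]\<^bsub>A\<^esub> (\<psi> b u)) U"
  have P_closed: "?P b \<in> carrier A" for b
    by (intro A.finprod_closed) auto
  have P_mult: "?P (b \<otimes> b') = ?P b \<otimes>\<^bsub>A\<^esub> ?P b'" if "b \<in> carrier B" "b' \<in> carrier B" for b b'
  proof -
    have "?P (b \<otimes> b') = finprod A (\<lambda>u. c u [^]\<^bsub>A\<^esub> \<psi> b u \<otimes>\<^bsub>A\<^esub> c u [^]\<^bsub>A\<^esub> \<psi> b' u) U"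
      using that by (intro A.finprod_cong') (auto simp: add A.int_pow_mult)
    also have "\<dots> = ?P b \<otimes>\<^bsub>A\<^esub> ?P b'"
      by (intro A.finprod_multf) auto
    finally show ?thesis .
  qed
  \<comment> \<open>Additivity at the unit forces all its exponents to be 0.\<close>
  have P_one: "?P \<one> = \<one>\<^bsub>A\<^esub>"
    using add[OF one_closed one_closed] by (intro A.finprod_one_eqI) auto
  show ?thesis using b
  proof (induction b rule: gen_induct)
    case one
    then show ?case using P_one by simp
  next
    case (gen x)
    show ?case using assms(6)[OF gen]
    proof (elim disjE conjE bexE)
      assume "q (gen x) = \<one>\<^bsub>A\<^esub>" "\<forall>u\<in>U. \<psi> (gen x) u = 0"
      then show ?thesis by (simp add: A.finprod_one_eqI)
    next
      fix w assume w: "w \<in> U" "q (gen x) = c w" "\<forall>u\<in>U. \<psi> (gen x) u = (if u = w then 1 else 0)"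
      have "?P (gen x) = finprod A (\<lambda>u. if u = w then c u else \<one>\<^bsub>A\<^esub>) U"
        using w by (intro A.finprod_cong') auto
      also have "\<dots> = c w"
        using w U by (intro A.finprod_singleton_swap)
      finally show ?thesis using w by simp
    qed
  next
    case (inv b)
    have "?P (inv b) \<otimes>\<^bsub>A\<^esub> ?P b = \<one>\<^bsub>A\<^esub>"
      using P_mult[of "inv b" b] inv.hyps P_one by simp
    then have "?P (inv b) = inv\<^bsub>A\<^esub> ?P b"
      using P_closed by (intro A.inv_equality[symmetric]) auto
    then show ?case using inv by simp
  next
    case (mult b b')
    then show ?case using P_mult by simp
  qed
qed

text \<open>One half of the intersection form of the handles: subtracting the form with exchanged
  arguments gives the symplectic form in the basis \<open>a_i\<close>, \<open>b_i\<close>. Keeping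
  only one half lets it serve as a bilinear cocycle with integer values.\<close>

definition handle_form :: "nat \<Rightarrow> (braid_gen \<Rightarrow> int) \<Rightarrow> (braid_gen \<Rightarrow> int) \<Rightarrow> int" where
  "handle_form g v w = (\<Sum>i=1..g. v (Aa i) * w (Bb i))"

definition unit_vec :: "braid_gen \<Rightarrow> braid_gen \<Rightarrow> int" where
  "unit_vec u w = (if w = u then 1 else 0)"

lemma handle_form_add [simp]:
  "handle_form g (v + v') w = handle_form g v w + handle_form g v' w"
  "handle_form g v (w + w') = handle_form g v w + handle_form g v w'"
  by (simp_all add: handle_form_def algebra_simps sum.distrib)

lemma handle_form_0 [simp]: "handle_form g 0 w = 0" "handle_form g v 0 = 0"
  by (simp_all add: handle_form_def)

lemma handle_form_minus [simp]: "handle_form g (- v) w = - handle_form g v w"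
  by (simp add: handle_form_def sum_negf)

lemma handle_form_unit_left:
  "handle_form g (unit_vec u) w = (\<Sum>i=1..g. if u = Aa i then w (Bb i) else 0)"
  unfolding handle_form_def unit_vec_def by (intro sum.cong) auto

lemma handle_form_unit_right:
  "handle_form g v (unit_vec u) = (\<Sum>i=1..g. if u = Bb i then v (Aa i) else 0)"
  unfolding handle_form_def unit_vec_def by (intro sum.cong) auto

lemma handle_form_unit_simps [simp]:
  "handle_form g (unit_vec (Sig i)) w = 0" "handle_form g v (unit_vec (Sig i)) = 0"
  "handle_form g (unit_vec (Zeta i)) w = 0" "handle_form g v (unit_vec (Zeta i)) = 0"
  "handle_form g (unit_vec (Bb i)) w = 0" "handle_form g v (unit_vec (Aa i)) = 0"
  "1 \<le> i \<Longrightarrow> i \<le> g \<Longrightarrow> handle_form g (unit_vec (Aa i)) w = w (Bb i)"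
  "1 \<le> i \<Longrightarrow> i \<le> g \<Longrightarrow> handle_form g v (unit_vec (Bb i)) = v (Aa i)"
  by (simp_all add: handle_form_unit_left handle_form_unit_right)

text \<open>The nilpotent group of class 2 in which \<open>\<sigma> = (1, 0)\<close> is central and
  \<open>[a\<^sub>i, b\<^sub>i] = \<sigma>\<^sup>2\<close>. The second component records the exponents of \<open>a\<^sub>i\<close>, \<open>b\<^sub>i\<close> and \<open>\<zeta>\<^sub>i\<close>.\<close>

definition heisenberg :: "nat \<Rightarrow> (int \<times> (braid_gen \<Rightarrow> int)) monoid" where
  "heisenberg g = \<lparr>carrier = UNIV,
     mult = (\<lambda>x y. (fst x + fst y + 2 * handle_form g (snd x) (snd y), snd x + snd y)),
     one = (0, 0)\<rparr>"

lemma heisenberg_simps [simp]: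
  "carrier (heisenberg g) = UNIV"
  "\<one>\<^bsub>heisenberg g\<^esub> = (0, 0)"
  "x \<otimes>\<^bsub>heisenberg g\<^esub> y = (fst x + fst y + 2 * handle_form g (snd x) (snd y), snd x + snd y)"
  by (simp_all add: heisenberg_def)

lemma group_heisenberg: "group (heisenberg g)"
proof (rule groupI)
  fix x
  show "\<exists>y\<in>carrier (heisenberg g). y \<otimes>\<^bsub>heisenberg g\<^esub> x = \<one>\<^bsub>heisenberg g\<^esub>"
    \<comment> \<open>With second component \<open>- snd x\<close>, the cocycle contributes
      \<open>- 2 * handle_form g (snd x) (snd x)\<close>, which the first component has to
      compensate.\<close>
    by (intro bexI[of _ "(2 * handle_form g (snd x) (snd x) - fst x, - snd x)"]) simp_all
qed (simp_all add: algebra_simps)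

text \<open>The \<zeta>_i get coordinates of their own, which \<open>handle_form\<close> never
  reads, so they are central while their exponents stay visible.\<close>

fun heisenberg_gen :: "braid_gen \<Rightarrow> int \<times> (braid_gen \<Rightarrow> int)" where
  "heisenberg_gen (Sig i) = (1, 0)"
| "heisenberg_gen u = (0, unit_vec u)"

lemma inv_heisenberg_sigma [simp]: "inv\<^bsub>heisenberg g\<^esub> (1, 0) = (- 1, 0)"
  by (rule group.inv_equality[OF group_heisenberg]) simp_all

lemma heisenberg_gen_AB_Z:
  "u \<in> AB_gens g \<union> Z_gens n \<Longrightarrow> heisenberg_gen u = (0, unit_vec u)"
  by (auto simp: AB_gens_def Z_gens_def)

text \<open>The decisive case is the handle relation. On the left \<open>a_i\<close> precedes
  \<open>b_i\<close>, so one \<sigma> and the cocycle value 2 give 3; on the right the cocycle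
  vanishes and there are three \<sigma>. Generators of different handles pair to 0 in either
  order.\<close>

lemma heisenberg_relations:
  assumes "(l, r) \<in> braid_rels k g n"
  shows "word_eval (heisenberg g) heisenberg_gen l = word_eval (heisenberg g) heisenberg_gen r"
  using assms
proof (cases rule: braid_rels.cases)
  case (handle i)
  then show ?thesis by (simp add: unit_vec_def add.commute)
next
  case (square c)
  then show ?thesis by (simp add: heisenberg_gen_AB_Z)
next
  case (handles c d)
  then obtain i j where "1 \<le> i" "i < j" "j \<le> g" "c \<in> {Aa i, Bb i}" "d \<in> {Aa j, Bb j}"
    by (auto simp: AB_less_def)
  with handles show ?thesis by (auto simp: unit_vec_def add.commute)
next
  case (puncture_handle i c)
  then have "heisenberg_gen c = (0, unit_vec c)" by (auto intro: heisenberg_gen_AB_Z)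
  with puncture_handle show ?thesis by (simp add: add.commute)
qed (auto simp: heisenberg_gen_AB_Z add.commute)

lemma heisenberg_hom:
  assumes "presented B \<gamma> (braid_gens k g n) (braid_rels k g n)"
  obtains \<Phi> where "\<Phi> \<in> hom B (heisenberg g)"
    "\<And>u. u \<in> braid_gens k g n \<Longrightarrow> \<Phi> (\<gamma> u) = heisenberg_gen u"
  using presented.universal_property[OF assms group_heisenberg, of heisenberg_gen g]
    heisenberg_relations by (auto simp: Pi_iff)

section \<open>The centre of \<open>B/\<Gamma>\<^sub>3(B)\<close>\<close>

lemma sigma_constant:
  assumes "\<And>i. 1 \<le> i \<Longrightarrow> Suc i < k \<Longrightarrow> h (Sig i) = h (Sig (Suc i))" and "1 \<le> i" "i < k"
  shows "h (Sig i) = h (Sig 1)"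
  using assms(2,3) by (induction i rule: dec_induct) (use assms(1) in auto)

lemma image_S_gens:
  assumes "\<And>i. 1 \<le> i \<Longrightarrow> i < k \<Longrightarrow> h (Sig i) = c" "3 \<le> k"
  shows "h ` S_gens k = {c}"
proof -
  have "h ` S_gens k = (\<lambda>i. c) ` {1..<k}"
    unfolding S_gens_def image_image by (rule image_cong) (use assms in auto)
  then show ?thesis using assms(2) by (simp add: image_constant_conv)
qed

lemma sigma_braid_relation:
  assumes "presented B \<gamma> (braid_gens k g n) (braid_rels k g n)" "group G" "f \<in> hom B G"
    and "1 \<le> i" "Suc i < k"
  defines "s \<equiv> f (\<gamma> (Sig i))" and "t \<equiv> f (\<gamma> (Sig (Suc i)))"
  shows "s \<otimes>\<^bsub>G\<^esub> t \<otimes>\<^bsub>G\<^esub> s = t \<otimes>\<^bsub>G\<^esub> s \<otimes>\<^bsub>G\<^esub> t" "s \<in> carrier G" "t \<in> carrier G"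
proof -
  interpret B: presented B \<gamma> "braid_gens k g n" "braid_rels k g n" by fact
  interpret G: group G by fact
  have g: "Sig i \<in> braid_gens k g n" "Sig (Suc i) \<in> braid_gens k g n"
    "Sig i \<in> S_gens k" "Sig (Suc i) \<in> S_gens k"
    using assms(4,5) by (auto simp: braid_gens_def S_gens_def)
  show st: "s \<in> carrier G" "t \<in> carrier G"
    unfolding s_def t_def using g assms(3) by (auto intro: hom_in_carrier)
  show "s \<otimes>\<^bsub>G\<^esub> t \<otimes>\<^bsub>G\<^esub> s = t \<otimes>\<^bsub>G\<^esub> s \<otimes>\<^bsub>G\<^esub> t"
    using B.hom_relation[OF assms(2,3) braid_rels.braid[OF g(3,4)]] g st
    by (simp add: G.m_assoc flip: s_def t_def)
qed

text \<open>If neighbours \<open>s\<close>, \<open>t\<close> commute, the braid relation reads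
  \<open>s (t s) = t (t s)\<close>, and \<open>t s\<close> cancels.\<close>

lemma sigma_constant_if_commuting:
  assumes B: "presented B \<gamma> (braid_gens k g n) (braid_rels k g n)" and G: "group G" "f \<in> hom B G"
    and comm: "\<And>b c. b \<in> carrier B \<Longrightarrow> c \<in> carrier B \<Longrightarrow> f b \<otimes>\<^bsub>G\<^esub> f c = f c \<otimes>\<^bsub>G\<^esub> f b"
    and "1 \<le> i" "i < k"
  shows "f (\<gamma> (Sig i)) = f (\<gamma> (Sig 1))"
proof -
  interpret B: presented B \<gamma> "braid_gens k g n" "braid_rels k g n" by fact
  interpret G: group G by fact
  have "f (\<gamma> (Sig i)) = f (\<gamma> (Sig (Suc i)))" if i: "1 \<le> i" "Suc i < k" for i
  proof -
    let ?s = "f (\<gamma> (Sig i))" and ?t = "f (\<gamma> (Sig (Suc i)))"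
    note rel = sigma_braid_relation[OF B G i]
    have "Sig i \<in> braid_gens k g n" "Sig (Suc i) \<in> braid_gens k g n"
      using i by (auto simp: braid_gens_def S_gens_def)
    then have "?s \<otimes>\<^bsub>G\<^esub> ?t = ?t \<otimes>\<^bsub>G\<^esub> ?s"
      by (intro comm) auto
    then have "?s \<otimes>\<^bsub>G\<^esub> (?t \<otimes>\<^bsub>G\<^esub> ?s) = ?t \<otimes>\<^bsub>G\<^esub> (?t \<otimes>\<^bsub>G\<^esub> ?s)"
      using rel by (simp add: G.m_assoc)
    then show "?s = ?t" using rel by simp
  qed
  then show ?thesis
    using sigma_constant[of k "\<lambda>u. f (\<gamma> u)", OF _ assms(5,6)] by blast
qed

text \<open>This is all that the algebra takes from the topology: two presentations, with genus 0
  for the disc, and a homomorphism that matches generators by name.\<close>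

locale braid_pair =
  B: presented B \<gamma> "braid_gens k g n" "braid_rels k g n" +
  D: presented D \<delta> "braid_gens k 0 n" "braid_rels k 0 n" +
  \<iota>: group_hom D B \<iota>
  for B :: "('b, 'm) monoid_scheme" and \<gamma> k g n and D :: "('d, 'l) monoid_scheme" and \<delta> \<iota> +
  assumes k: "3 \<le> k" and \<iota>_gen: "\<And>u. u \<in> braid_gens k 0 n \<Longrightarrow> \<iota> (\<delta> u) = \<gamma> u"
begin

section \<open>The quotients of the two braid groups and the kernel of the comparison map\<close>

abbreviation \<Gamma>3 where "\<Gamma>3 \<equiv> lower_central B 3"
abbreviation \<Gamma>2 where "\<Gamma>2 \<equiv> lower_central D 2"
abbreviation \<rho> where "\<rho> \<equiv> \<lambda>b. \<Gamma>3 #>\<^bsub>B\<^esub> b"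
abbreviation r where "r \<equiv> \<lambda>d. \<Gamma>2 #>\<^bsub>D\<^esub> d"

sublocale N3: normal \<Gamma>3 B by (rule B.lower_central_normal)
sublocale N2: normal \<Gamma>2 D by (rule D.lower_central_normal)
sublocale \<rho>: group_hom B "B Mod \<Gamma>3" \<rho> by (rule N3.coset_group_hom)
sublocale r: group_hom D "D Mod \<Gamma>2" r by (rule N2.coset_group_hom)

lemma D_gens: "braid_gens k 0 n = S_gens k \<union> Z_gens n"
  by (auto simp: braid_gens_def AB_gens_def)

lemma D_gens_subset: "u \<in> braid_gens k 0 n \<Longrightarrow> u \<in> braid_gens k g n"
  by (auto simp: braid_gens_def AB_gens_def)

lemma Sig_gens: "1 \<le> i \<Longrightarrow> i < k \<Longrightarrow> Sig i \<in> braid_gens k g' n"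
  by (auto simp: braid_gens_def S_gens_def)

lemma commutator_in_\<Gamma>2:
  assumes "a \<in> carrier D" "b \<in> carrier D"
  shows "a \<otimes>\<^bsub>D\<^esub> b \<otimes>\<^bsub>D\<^esub> inv\<^bsub>D\<^esub> a \<otimes>\<^bsub>D\<^esub> inv\<^bsub>D\<^esub> b \<in> \<Gamma>2"
  using D.commutator_in_lower_central[of a b 0] assms by (simp add: numeral_2_eq_2)

lemma r_commute:
  assumes "a \<in> carrier D" "b \<in> carrier D"
  shows "r a \<otimes>\<^bsub>D Mod \<Gamma>2\<^esub> r b = r b \<otimes>\<^bsub>D Mod \<Gamma>2\<^esub> r a"
  using r.commute_iff[OF assms] commutator_in_\<Gamma>2[OF assms] N2.coset_eq_one_iff N2.mem_carrier by blast

lemma FactGroup_carrierE: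
  assumes "q \<in> carrier (B Mod \<Gamma>3)"
  obtains b where "b \<in> carrier B" "q = \<rho> b"
  using assms by (auto simp: carrier_FactGroup)

lemma \<rho>_commutator_central:
  assumes "b \<in> carrier B" "c \<in> carrier B" "x \<in> carrier B"
  shows "\<rho> (b \<otimes>\<^bsub>B\<^esub> c \<otimes>\<^bsub>B\<^esub> inv\<^bsub>B\<^esub> b \<otimes>\<^bsub>B\<^esub> inv\<^bsub>B\<^esub> c) \<otimes>\<^bsub>B Mod \<Gamma>3\<^esub> \<rho> x
    = \<rho> x \<otimes>\<^bsub>B Mod \<Gamma>3\<^esub> \<rho> (b \<otimes>\<^bsub>B\<^esub> c \<otimes>\<^bsub>B\<^esub> inv\<^bsub>B\<^esub> b \<otimes>\<^bsub>B\<^esub> inv\<^bsub>B\<^esub> c)"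
proof -
  let ?z = "b \<otimes>\<^bsub>B\<^esub> c \<otimes>\<^bsub>B\<^esub> inv\<^bsub>B\<^esub> b \<otimes>\<^bsub>B\<^esub> inv\<^bsub>B\<^esub> c"
  have z: "?z \<in> carrier B" using assms by simp
  have "?z \<in> lower_central B (Suc (Suc 0))"
    using B.commutator_in_lower_central[of b c 0] assms by simp
  then have "x \<otimes>\<^bsub>B\<^esub> ?z \<otimes>\<^bsub>B\<^esub> inv\<^bsub>B\<^esub> x \<otimes>\<^bsub>B\<^esub> inv\<^bsub>B\<^esub> ?z \<in> \<Gamma>3"
    using B.commutator_in_lower_central[OF assms(3)] unfolding numeral_3_eq_3 by blast
  then have "\<rho> (x \<otimes>\<^bsub>B\<^esub> ?z \<otimes>\<^bsub>B\<^esub> inv\<^bsub>B\<^esub> x \<otimes>\<^bsub>B\<^esub> inv\<^bsub>B\<^esub> ?z) = \<one>\<^bsub>B Mod \<Gamma>3\<^esub>"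
    using N3.coset_eq_one_iff N3.mem_carrier by blast
  then show ?thesis using \<rho>.commute_iff[OF assms(3) z] by metis
qed

text \<open>Commutators are central modulo \<open>\<Gamma>3\<close>, so
  \<open>braid_relation_collapse\<close> identifies neighbouring \<sigma>_i, and everything proved
  in \<open>braid_rep\<close> becomes available for the projection.\<close>

sublocale \<rho>: braid_rep B \<gamma> k g n "B Mod \<Gamma>3" \<rho> "\<rho> (\<gamma> (Sig 1))"
proof unfold_locales
  fix i assume i: "1 \<le> i" "i < k"
  have "\<rho> (\<gamma> (Sig i)) = \<rho> (\<gamma> (Sig (Suc i)))" if "1 \<le> i" "Suc i < k" for i
  proof (rule \<rho>.H.braid_relation_collapse)
    note rel = sigma_braid_relation[OF B.presented_axioms \<rho>.H.group_axioms \<rho>.homh that]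
    from rel show "\<rho> (\<gamma> (Sig i)) \<in> carrier (B Mod \<Gamma>3)" "\<rho> (\<gamma> (Sig (Suc i))) \<in> carrier (B Mod \<Gamma>3)"
      "\<rho> (\<gamma> (Sig i)) \<otimes>\<^bsub>B Mod \<Gamma>3\<^esub> \<rho> (\<gamma> (Sig (Suc i))) \<otimes>\<^bsub>B Mod \<Gamma>3\<^esub> \<rho> (\<gamma> (Sig i))
        = \<rho> (\<gamma> (Sig (Suc i))) \<otimes>\<^bsub>B Mod \<Gamma>3\<^esub> \<rho> (\<gamma> (Sig i)) \<otimes>\<^bsub>B Mod \<Gamma>3\<^esub> \<rho> (\<gamma> (Sig (Suc i)))"
      by blast+
    fix x y z assume "x \<in> carrier (B Mod \<Gamma>3)" "y \<in> carrier (B Mod \<Gamma>3)" "z \<in> carrier (B Mod \<Gamma>3)"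
    then obtain a b c where abc: "a \<in> carrier B" "x = \<rho> a" "b \<in> carrier B" "y = \<rho> b" "c \<in> carrier B" "z = \<rho> c"
      by (meson FactGroup_carrierE)
    show "x \<otimes>\<^bsub>B Mod \<Gamma>3\<^esub> y \<otimes>\<^bsub>B Mod \<Gamma>3\<^esub> inv\<^bsub>B Mod \<Gamma>3\<^esub> x \<otimes>\<^bsub>B Mod \<Gamma>3\<^esub> inv\<^bsub>B Mod \<Gamma>3\<^esub> y \<otimes>\<^bsub>B Mod \<Gamma>3\<^esub> z
      = z \<otimes>\<^bsub>B Mod \<Gamma>3\<^esub> (x \<otimes>\<^bsub>B Mod \<Gamma>3\<^esub> y \<otimes>\<^bsub>B Mod \<Gamma>3\<^esub> inv\<^bsub>B Mod \<Gamma>3\<^esub> x \<otimes>\<^bsub>B Mod \<Gamma>3\<^esub> inv\<^bsub>B Mod \<Gamma>3\<^esub> y)"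
      using \<rho>_commutator_central[OF abc(1,3,5)] abc by (simp del: mult_FactGroup)
  qed
  then show "\<rho> (\<gamma> (Sig i)) = \<rho> (\<gamma> (Sig 1))"
    using sigma_constant[of k "\<lambda>u. \<rho> (\<gamma> u)", OF _ i] by blast
qed (rule k)

lemma \<rho>_\<iota>_central:
  assumes "d \<in> carrier D"
  shows "\<rho> (\<iota> d) \<in> \<rho>.central"
proof -
  interpret C: subgroup \<rho>.central "B Mod \<Gamma>3" by (rule \<rho>.subgroup_central)
  show ?thesis using assms
  proof (induction d rule: D.gen_induct)
    case one
    then show ?case using C.one_closed by (simp del: one_FactGroup)
  next
    case (gen u)
    show ?case
      using gen unfolding D_gens
    proof
      assume "u \<in> S_gens k"
      then obtain i where "u = Sig i" "1 \<le> i" "i < k" by (auto simp: S_gens_def)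
      then have "\<rho> (\<iota> (\<delta> u)) = \<rho> (\<gamma> (Sig 1))"
        using \<iota>_gen[OF gen] \<rho>.f_sigma by metis
      then show ?thesis using \<rho>.s_central by metis
    next
      assume "u \<in> Z_gens n"
      then show ?thesis using \<rho>.Zeta_central \<iota>_gen[OF gen] by metis
    qed
  next
    case (inv d)
    then show ?case using C.m_inv_closed by simp
  next
    case (mult d d')
    then show ?case using C.m_closed by (simp del: mult_FactGroup)
  qed
qed

text \<open>Central elements commute with one another, so \<open>D\<close> has abelian image. This
  is what makes the map on \<open>D Mod \<Gamma>2\<close> well defined.\<close>

lemma \<rho>_\<iota>_trivial: "d \<in> \<Gamma>2 \<Longrightarrow> \<rho> (\<iota> d) = \<one>\<^bsub>B Mod \<Gamma>3\<^esub>"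
proof -
  interpret c: group_hom D "B Mod \<Gamma>3" "\<rho> \<circ> \<iota>"
    using Group.hom_compose[OF \<iota>.homh \<rho>.homh]
    by (simp add: group_hom_def group_hom_axioms_def D.group_axioms \<rho>.H.group_axioms)
  assume "d \<in> \<Gamma>2"
  then have "(\<rho> \<circ> \<iota>) d = \<one>\<^bsub>B Mod \<Gamma>3\<^esub>"
  proof (rule c.trivial_on_lower_central_2[rotated])
    fix a b assume "a \<in> carrier D" "b \<in> carrier D"
    then show "(\<rho> \<circ> \<iota>) a \<otimes>\<^bsub>B Mod \<Gamma>3\<^esub> (\<rho> \<circ> \<iota>) b = (\<rho> \<circ> \<iota>) b \<otimes>\<^bsub>B Mod \<Gamma>3\<^esub> (\<rho> \<circ> \<iota>) a"
      unfolding o_apply by (intro \<rho>.central_commute \<rho>_\<iota>_central \<iota>.hom_closed)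
  qed
  then show "\<rho> (\<iota> d) = \<one>\<^bsub>B Mod \<Gamma>3\<^esub>" unfolding o_apply .
qed

lemma \<iota>_\<Gamma>2: "d \<in> \<Gamma>2 \<Longrightarrow> \<iota> d \<in> \<Gamma>3"
  using \<rho>_\<iota>_trivial N3.coset_eq_one_iff \<iota>.hom_closed N2.mem_carrier by blast

lemma trivial_on_\<Gamma>3_if_sigma_constant:
  assumes "group G" "f \<in> hom B G" "f ` \<gamma> ` S_gens k = {s}" "b \<in> \<Gamma>3"
  shows "f b = \<one>\<^bsub>G\<^esub>"
proof -
  interpret braid_rep B \<gamma> k g n G f s
    by (intro braid_rep.intro group_hom.intro B.presented_axioms group_hom_axioms.intro
        B.group_axioms assms(1,2) braid_rep_axioms.intro k)
      (use assms(3) in \<open>auto simp: S_gens_def\<close>)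
  show ?thesis using assms(4) by (rule trivial_on_Gamma3)
qed

text \<open>Commutators of \<open>D\<close> die, so the image of \<open>D\<close> is abelian, and
  the braid relations inside \<open>D\<close> already identify the \<sigma>_i.\<close>

lemma sigma_constant_if_trivial_on_\<Gamma>2:
  assumes "group G" "f \<in> hom B G" "\<And>d. d \<in> \<Gamma>2 \<Longrightarrow> f (\<iota> d) = \<one>\<^bsub>G\<^esub>"
  shows "f (\<gamma> (Sig 1)) \<in> carrier G" "f ` \<gamma> ` S_gens k = {f (\<gamma> (Sig 1))}"
proof -
  interpret f: group_hom D G "f \<circ> \<iota>"
    using hom_compose[OF \<iota>.homh assms(2)] assms(1)
    by (simp add: group_hom_def group_hom_axioms_def D.group_axioms)
  have comm: "(f \<circ> \<iota>) b \<otimes>\<^bsub>G\<^esub> (f \<circ> \<iota>) c = (f \<circ> \<iota>) c \<otimes>\<^bsub>G\<^esub> (f \<circ> \<iota>) b"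
    if bc: "b \<in> carrier D" "c \<in> carrier D" for b c
    using f.commute_iff[OF bc] assms(3)[OF commutator_in_\<Gamma>2[OF bc]] by simp
  have "f (\<gamma> (Sig i)) = f (\<gamma> (Sig 1))" if "1 \<le> i" "i < k" for i
    using sigma_constant_if_commuting[OF D.presented_axioms assms(1) f.homh comm that] that
      Sig_gens[of i 0] Sig_gens[of 1 0] by (simp add: \<iota>_gen)
  then show "f ` \<gamma> ` S_gens k = {f (\<gamma> (Sig 1))}"
    unfolding image_image by (intro image_S_gens k)
  show "f (\<gamma> (Sig 1)) \<in> carrier G"
    using hom_in_carrier[OF assms(2)] Sig_gens[of 1 g] k by simp
qed

text \<open>Exponents measured in \<open>B\<close> control the class of \<open>d\<close> in
  \<open>D Mod \<Gamma>2\<close>: the Heisenberg representation kills \<open>\<Gamma>3\<close>, so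
  all of them are 0, and \<open>r d\<close> is a product of generator classes raised to these
  exponents.\<close>

lemma \<iota>_\<Gamma>3_imp_\<Gamma>2:
  assumes d: "d \<in> carrier D" and "\<iota> d \<in> \<Gamma>3"
  shows "d \<in> \<Gamma>2"
proof -
  obtain \<Phi> where \<Phi>: "\<Phi> \<in> hom B (heisenberg g)"
    "\<And>u. u \<in> braid_gens k g n \<Longrightarrow> \<Phi> (\<gamma> u) = heisenberg_gen u"
    using heisenberg_hom[OF B.presented_axioms] by blast
  interpret \<Phi>: group_hom B "heisenberg g" \<Phi>
    by (simp add: group_hom_def group_hom_axioms_def B.group_axioms group_heisenberg \<Phi>(1))
  have Phi_gen: "\<Phi> (\<iota> (\<delta> u)) = heisenberg_gen u" if "u \<in> braid_gens k 0 n" for u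
    using that \<Phi>(2) D_gens_subset \<iota>_gen by simp
  \<comment> \<open>The first Heisenberg coordinate is not additive on all of \<open>B\<close>. On
    the image of \<open>D\<close> the left factor has no \<open>a_i\<close>-coordinates, so the
    cocycle term disappears.\<close>
  have Aa: "snd (\<Phi> (\<iota> d)) (Aa i) = 0" if "d \<in> carrier D" for d i
    using that
  proof (induction d rule: D.gen_induct)
    case (gen u)
    then show ?case
      using Phi_gen[OF gen] by (auto simp: D_gens S_gens_def Z_gens_def unit_vec_def)
  next
    case (inv d)
    have "\<Phi> (\<iota> (inv\<^bsub>D\<^esub> d)) \<otimes>\<^bsub>heisenberg g\<^esub> \<Phi> (\<iota> d) = \<one>\<^bsub>heisenberg g\<^esub>"
      using inv.hyps by (simp del: heisenberg_simps)
    then have "snd (\<Phi> (\<iota> (inv\<^bsub>D\<^esub> d))) + snd (\<Phi> (\<iota> d)) = 0" by simp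
    then show ?case using inv.IH by (metis add.right_neutral plus_fun_apply zero_fun_apply)
  next
    case (mult d d')
    then show ?case by simp
  qed simp
  \<comment> \<open>\<open>Sig 1\<close> represents all the \<sigma>_i, whose total exponent sits in
    the first coordinate; each \<zeta>_i has its exponent at its own index in the second.\<close>
  define \<psi> where "\<psi> d u = (if u = Sig 1 then fst (\<Phi> (\<iota> d)) else snd (\<Phi> (\<iota> d)) u)" for d u
  let ?U = "insert (Sig 1) (Z_gens n)"
  have comm: "comm_group (D Mod \<Gamma>2)"
  proof (rule r.H.group_comm_groupI)
    fix x y assume "x \<in> carrier (D Mod \<Gamma>2)" "y \<in> carrier (D Mod \<Gamma>2)"
    then obtain a b where ab: "a \<in> carrier D" "b \<in> carrier D" "x = r a" "y = r b"
      by (auto simp: carrier_FactGroup)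
    then show "x \<otimes>\<^bsub>D Mod \<Gamma>2\<^esub> y = y \<otimes>\<^bsub>D Mod \<Gamma>2\<^esub> x"
      using r_commute by simp
  qed
  have r_sigma: "r (\<delta> (Sig i)) = r (\<delta> (Sig 1))" if "1 \<le> i" "i < k" for i
    by (rule sigma_constant_if_commuting[OF D.presented_axioms r.H.group_axioms r.homh r_commute that])
  have "r d = finprod (D Mod \<Gamma>2) (\<lambda>u. r (\<delta> u) [^]\<^bsub>D Mod \<Gamma>2\<^esub> \<psi> d u) ?U"
  proof (rule D.comm_hom_eval[OF comm r.homh _ _ _ _ d])
    show "finite ?U" by (simp add: Z_gens_def)
    show "(\<lambda>u. r (\<delta> u)) \<in> ?U \<rightarrow> carrier (D Mod \<Gamma>2)"
      using k Sig_gens[of 1 0] by (auto intro!: r.hom_closed simp: D_gens)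
    show "\<psi> (a \<otimes>\<^bsub>D\<^esub> b) u = \<psi> a u + \<psi> b u" if "a \<in> carrier D" "b \<in> carrier D" for a b u
      using that Aa by (simp add: \<psi>_def handle_form_def)
    fix x assume x: "x \<in> braid_gens k 0 n"
    have "\<exists>w\<in>?U. r (\<delta> x) = r (\<delta> w) \<and> (\<forall>u\<in>?U. \<psi> (\<delta> x) u = (if u = w then 1 else 0))"
      using x unfolding D_gens
    proof
      assume "x \<in> S_gens k"
      then obtain i where i: "x = Sig i" "1 \<le> i" "i < k" by (auto simp: S_gens_def)
      then show ?thesis
        using r_sigma[OF i(2,3)] Phi_gen[OF x] by (intro bexI[of _ "Sig 1"]) (auto simp: \<psi>_def Z_gens_def)
    next
      assume "x \<in> Z_gens n"
      then show ?thesis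
        using Phi_gen[OF x] by (intro bexI[of _ x]) (auto simp: \<psi>_def Z_gens_def unit_vec_def split: if_splits)
    qed
    then show "r (\<delta> x) = \<one>\<^bsub>D Mod \<Gamma>2\<^esub> \<and> (\<forall>u\<in>?U. \<psi> (\<delta> x) u = 0)
      \<or> (\<exists>w\<in>?U. r (\<delta> x) = r (\<delta> w) \<and> (\<forall>u\<in>?U. \<psi> (\<delta> x) u = (if u = w then 1 else 0)))" by blast
  qed
  moreover have "\<Phi> (\<iota> d) = (0, 0)"
  proof -
    have "\<Phi> ` \<gamma> ` S_gens k = {(1, 0)}"
      unfolding image_image by (intro image_S_gens k) (simp add: \<Phi>(2) Sig_gens)
    from trivial_on_\<Gamma>3_if_sigma_constant[OF group_heisenberg \<Phi>(1) this assms(2)]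
    show ?thesis by simp
  qed
  ultimately have "r d = \<one>\<^bsub>D Mod \<Gamma>2\<^esub>"
    using comm by (simp add: \<psi>_def comm_monoid.finprod_one_eqI comm_group_def del: one_FactGroup)
  then show ?thesis using N2.coset_eq_one_iff d by blast
qed

text \<open>The projection is onto, so commuting with its image is the same as being
  central.\<close>

lemma \<rho>_\<iota>_in_centre:
  assumes "d \<in> carrier D"
  shows "\<rho> (\<iota> d) \<in> centre (B Mod \<Gamma>3)"
  unfolding centre_def
proof (intro CollectI conjI ballI)
  show "\<rho> (\<iota> d) \<in> carrier (B Mod \<Gamma>3)" using assms by simp
  fix q assume "q \<in> carrier (B Mod \<Gamma>3)"
  then obtain b where b: "b \<in> carrier B" "q = \<rho> b" by (rule FactGroup_carrierE)
  show "\<rho> (\<iota> d) \<otimes>\<^bsub>B Mod \<Gamma>3\<^esub> q = q \<otimes>\<^bsub>B Mod \<Gamma>3\<^esub> \<rho> (\<iota> d)"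
    unfolding b(2) by (rule \<rho>.central_commute[OF \<rho>_\<iota>_central[OF assms] b(1)])
qed

text \<open>The preimage in \<open>B\<close> of the prospective centre. Modulo \<open>K\<close> only
  the \<open>a_i\<close> and \<open>b_i\<close> survive, so membership can be tested by their
  exponents.\<close>

definition K where "K = {b \<in> carrier B. \<exists>d\<in>carrier D. \<rho> b = \<rho> (\<iota> d)}"

lemma K_normal: "K \<lhd> B"
proof (rule B.normal_invI[OF B.subgroupI])
  show "K \<subseteq> carrier B" by (auto simp: K_def)
  have "\<one>\<^bsub>B\<^esub> \<in> K" unfolding K_def
    by (intro CollectI conjI bexI[of _ "\<one>\<^bsub>D\<^esub>"]) simp_all
  then show "K \<noteq> {}" by blast
  fix b assume "b \<in> K"
  then obtain d where b: "b \<in> carrier B" and d: "d \<in> carrier D" "\<rho> b = \<rho> (\<iota> d)" by (auto simp: K_def)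
  have "\<rho> (inv\<^bsub>B\<^esub> b) = \<rho> (\<iota> (inv\<^bsub>D\<^esub> d))" using b d by simp
  then show "inv\<^bsub>B\<^esub> b \<in> K" using b d(1) unfolding K_def by blast
  show "b \<otimes>\<^bsub>B\<^esub> b' \<in> K" if "b' \<in> K" for b'
  proof -
    obtain d' where b': "b' \<in> carrier B" and d': "d' \<in> carrier D" "\<rho> b' = \<rho> (\<iota> d')"
      using \<open>b' \<in> K\<close> by (auto simp: K_def)
    have "\<rho> (b \<otimes>\<^bsub>B\<^esub> b') = \<rho> (\<iota> (d \<otimes>\<^bsub>D\<^esub> d'))"
      using b d b' d' by (simp del: mult_FactGroup)
    then show ?thesis using b b' d(1) d'(1) unfolding K_def by blast
  qed
  fix x assume x: "x \<in> carrier B"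
  \<comment> \<open>Conjugation does not move \<open>\<rho> b\<close>, which comes from
    \<open>D\<close> and is therefore central.\<close>
  have "\<rho> (x \<otimes>\<^bsub>B\<^esub> b \<otimes>\<^bsub>B\<^esub> inv\<^bsub>B\<^esub> x)
      = \<rho> x \<otimes>\<^bsub>B Mod \<Gamma>3\<^esub> \<rho> (\<iota> d) \<otimes>\<^bsub>B Mod \<Gamma>3\<^esub> inv\<^bsub>B Mod \<Gamma>3\<^esub> \<rho> x"
    using x b d by (simp del: mult_FactGroup)
  also have "\<dots> = \<rho> (\<iota> d) \<otimes>\<^bsub>B Mod \<Gamma>3\<^esub> \<rho> x \<otimes>\<^bsub>B Mod \<Gamma>3\<^esub> inv\<^bsub>B Mod \<Gamma>3\<^esub> \<rho> x"
    by (simp only: \<rho>.central_commute[OF \<rho>_\<iota>_central[OF d(1)] x])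
  also have "\<dots> = \<rho> (\<iota> d)"
    using x d(1) by (simp add: \<rho>.H.m_assoc del: mult_FactGroup one_FactGroup)
  finally show "x \<otimes>\<^bsub>B\<^esub> b \<otimes>\<^bsub>B\<^esub> inv\<^bsub>B\<^esub> x \<in> K"
    using x b d(1) unfolding K_def by blast
qed

sublocale K: normal K B by (rule K_normal)
sublocale q: group_hom B "B Mod K" "\<lambda>b. K #>\<^bsub>B\<^esub> b" by (rule K.coset_group_hom)

lemma \<iota>_K: "d \<in> carrier D \<Longrightarrow> \<iota> d \<in> K"
  unfolding K_def using \<iota>.hom_closed by blast

lemma \<gamma>_K:
  assumes "u \<in> braid_gens k 0 n"
  shows "K #>\<^bsub>B\<^esub> \<gamma> u = \<one>\<^bsub>B Mod K\<^esub>"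
proof -
  have "\<gamma> u \<in> K" using \<iota>_K[OF D.gen_closed[OF assms]] \<iota>_gen[OF assms] by metis
  then show ?thesis using K.coset_eq_one_iff K.mem_carrier by blast
qed

text \<open>The \<sigma>_i lie in \<open>K\<close>, so the projection is a \<open>braid_rep\<close>
  whose \<open>s\<close> is the unit, and the obstruction to commutativity vanishes.\<close>

lemma comm_group_Mod_K: "comm_group (B Mod K)"
proof (rule q.H.group_comm_groupI)
  interpret q: braid_rep B \<gamma> k g n "B Mod K" "\<lambda>b. K #>\<^bsub>B\<^esub> b" "\<one>\<^bsub>B Mod K\<^esub>"
    by unfold_locales (use k \<gamma>_K Sig_gens in blast)+
  fix x y assume "x \<in> carrier (B Mod K)" "y \<in> carrier (B Mod K)"
  then obtain b c where bc: "b \<in> carrier B" "c \<in> carrier B" "x = K #>\<^bsub>B\<^esub> b" "y = K #>\<^bsub>B\<^esub> c"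
    by (auto simp: carrier_FactGroup)
  show "x \<otimes>\<^bsub>B Mod K\<^esub> y = y \<otimes>\<^bsub>B Mod K\<^esub> x"
    unfolding bc(3,4)
    by (rule q.commute_if_s_square_trivial[OF _ bc(1,2)]) (rule q.H.l_one[OF q.H.one_closed])
qed

lemma centre_subset:
  assumes "z \<in> centre (B Mod \<Gamma>3)"
  shows "\<exists>d\<in>carrier D. z = \<rho> (\<iota> d)"
proof -
  obtain b where b: "b \<in> carrier B" "z = \<rho> b"
    using assms by (auto simp: centre_def elim: FactGroup_carrierE)
  obtain \<Phi> where \<Phi>: "\<Phi> \<in> hom B (heisenberg g)"
    "\<And>u. u \<in> braid_gens k g n \<Longrightarrow> \<Phi> (\<gamma> u) = heisenberg_gen u"
    using heisenberg_hom[OF B.presented_axioms] by blast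
  interpret \<Phi>: group_hom B "heisenberg g" \<Phi>
    by (simp add: group_hom_def group_hom_axioms_def B.group_axioms group_heisenberg \<Phi>(1))
  have \<Phi>_S: "\<Phi> ` \<gamma> ` S_gens k = {(1, 0)}"
    unfolding image_image by (intro image_S_gens k) (simp add: \<Phi>(2) Sig_gens)
  \<comment> \<open>Since \<open>z\<close> is central, the commutators of \<open>b\<close> with
    generators lie in \<open>\<Gamma>3\<close>, which \<open>\<Phi>\<close> kills because it
    identifies the \<sigma>_i.\<close>
  have commute: "\<Phi> b \<otimes>\<^bsub>heisenberg g\<^esub> heisenberg_gen u = heisenberg_gen u \<otimes>\<^bsub>heisenberg g\<^esub> \<Phi> b"
    if u: "u \<in> braid_gens k g n" for u
  proof -
    have \<gamma>u: "\<gamma> u \<in> carrier B" using u by simp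
    have "\<rho> b \<otimes>\<^bsub>B Mod \<Gamma>3\<^esub> \<rho> (\<gamma> u) = \<rho> (\<gamma> u) \<otimes>\<^bsub>B Mod \<Gamma>3\<^esub> \<rho> b"
      using assms \<rho>.hom_closed[OF \<gamma>u] unfolding centre_def b(2) by blast
    then have "\<rho> (b \<otimes>\<^bsub>B\<^esub> \<gamma> u \<otimes>\<^bsub>B\<^esub> inv\<^bsub>B\<^esub> b \<otimes>\<^bsub>B\<^esub> inv\<^bsub>B\<^esub> \<gamma> u) = \<one>\<^bsub>B Mod \<Gamma>3\<^esub>"
      using \<rho>.commute_iff[OF b(1) \<gamma>u] by blast
    then have "b \<otimes>\<^bsub>B\<^esub> \<gamma> u \<otimes>\<^bsub>B\<^esub> inv\<^bsub>B\<^esub> b \<otimes>\<^bsub>B\<^esub> inv\<^bsub>B\<^esub> \<gamma> u \<in> \<Gamma>3"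
      using b(1) \<gamma>u by (subst (asm) N3.coset_eq_one_iff) simp_all
    from trivial_on_\<Gamma>3_if_sigma_constant[OF group_heisenberg \<Phi>(1) \<Phi>_S this]
    show ?thesis using \<Phi>.commute_iff[OF b(1) \<gamma>u] \<Phi>(2)[OF u] by metis
  qed
  \<comment> \<open>Exchanging the order of \<open>\<Phi> b\<close> and the image of
    \<open>a_i\<close> changes the first coordinate by twice the \<open>b_i\<close>-coordinate of
    \<open>\<Phi> b\<close>, up to sign. So commuting with \<open>a_i\<close> kills that coordinate,
    and commuting with \<open>b_i\<close> kills the other.\<close>
  have zero: "snd (\<Phi> b) u = 0" if u: "u \<in> AB_gens g" for u
  proof -
    obtain i where i: "1 \<le> i" "i \<le> g" "u = Aa i \<or> u = Bb i" using u by (auto simp: AB_gens_def)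
    then have "Aa i \<in> braid_gens k g n" "Bb i \<in> braid_gens k g n"
      by (auto simp: braid_gens_def AB_gens_def)
    from commute[OF this(1)] commute[OF this(2)] show ?thesis using i by auto
  qed
  \<comment> \<open>Unlike the first Heisenberg coordinate, the second is additive on all of
    \<open>B\<close>, so it can supply the exponents here.\<close>
  have "K #>\<^bsub>B\<^esub> b = finprod (B Mod K) (\<lambda>u. (K #>\<^bsub>B\<^esub> \<gamma> u) [^]\<^bsub>B Mod K\<^esub> snd (\<Phi> b) u) (AB_gens g)"
  proof (rule B.comm_hom_eval[OF comm_group_Mod_K q.homh _ _ _ _ b(1)])
    show "finite (AB_gens g)" by (simp add: AB_gens_def)
    show "(\<lambda>u. K #>\<^bsub>B\<^esub> \<gamma> u) \<in> AB_gens g \<rightarrow> carrier (B Mod K)"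
      by (intro funcsetI q.hom_closed) (simp add: braid_gens_def)
    show "snd (\<Phi> (c \<otimes>\<^bsub>B\<^esub> c')) u = snd (\<Phi> c) u + snd (\<Phi> c') u"
      if "c \<in> carrier B" "c' \<in> carrier B" for c c' u using that by simp
    fix u assume u: "u \<in> braid_gens k g n"
    show "K #>\<^bsub>B\<^esub> \<gamma> u = \<one>\<^bsub>B Mod K\<^esub> \<and> (\<forall>w\<in>AB_gens g. snd (\<Phi> (\<gamma> u)) w = 0)
      \<or> (\<exists>w\<in>AB_gens g. K #>\<^bsub>B\<^esub> \<gamma> u = K #>\<^bsub>B\<^esub> \<gamma> w
          \<and> (\<forall>w'\<in>AB_gens g. snd (\<Phi> (\<gamma> u)) w' = (if w' = w then 1 else 0)))"
    proof (cases "u \<in> AB_gens g")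
      case True
      then have "snd (\<Phi> (\<gamma> u)) = unit_vec u"
        using \<Phi>(2)[OF u] heisenberg_gen_AB_Z[of u g 0] by simp
      with True show ?thesis by (auto simp: unit_vec_def)
    next
      case False
      then have u0: "u \<in> braid_gens k 0 n" using u by (auto simp: braid_gens_def)
      then have "\<forall>w\<in>AB_gens g. snd (\<Phi> (\<gamma> u)) w = 0"
        using \<Phi>(2)[OF u] by (auto simp: D_gens S_gens_def Z_gens_def AB_gens_def unit_vec_def)
      with \<gamma>_K[OF u0] show ?thesis by blast
    qed
  qed
  also have "\<dots> = \<one>\<^bsub>B Mod K\<^esub>"
    using comm_group_Mod_K zero
    by (simp add: comm_monoid.finprod_one_eqI comm_group_def del: one_FactGroup)
  finally have "b \<in> K" using K.coset_eq_one_iff[OF b(1)] by blast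
  then show ?thesis unfolding b(2) K_def by blast
qed

lemma centre_eq: "centre (B Mod \<Gamma>3) = (\<lambda>d. \<rho> (\<iota> d)) ` carrier D"
  using centre_subset \<rho>_\<iota>_in_centre by blast

end

section \<open>The equivalences, the embedding onto the centre and the extension of
  homomorphisms\<close>

context braid_pair
begin

lemma factors_through_iff:
  assumes "group G" "f \<in> hom B G"
  shows "factors_through_quotient B \<Gamma>3 G f \<longleftrightarrow> factors_through_quotient D \<Gamma>2 G (f \<circ> \<iota>)"
    and "factors_through_quotient D \<Gamma>2 G (f \<circ> \<iota>) \<longleftrightarrow> (\<exists>s\<in>carrier G. f ` \<gamma> ` S_gens k = {s})"
proof -
  have f\<iota>: "f \<circ> \<iota> \<in> hom D G" by (rule Group.hom_compose[OF \<iota>.homh assms(2)])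
  note a = N3.factors_through_quotient_iff[OF assms] and b = N2.factors_through_quotient_iff[OF assms(1) f\<iota>]
  have ab: "\<forall>d\<in>\<Gamma>2. (f \<circ> \<iota>) d = \<one>\<^bsub>G\<^esub>" if "\<forall>b\<in>\<Gamma>3. f b = \<one>\<^bsub>G\<^esub>"
    using that \<iota>_\<Gamma>2 by simp
  have bc: "\<exists>s\<in>carrier G. f ` \<gamma> ` S_gens k = {s}" if "\<forall>d\<in>\<Gamma>2. (f \<circ> \<iota>) d = \<one>\<^bsub>G\<^esub>"
    using sigma_constant_if_trivial_on_\<Gamma>2[OF assms] that by auto
  have ca: "\<forall>b\<in>\<Gamma>3. f b = \<one>\<^bsub>G\<^esub>" if "\<exists>s\<in>carrier G. f ` \<gamma> ` S_gens k = {s}"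
    using trivial_on_\<Gamma>3_if_sigma_constant[OF assms] that by blast
  show "factors_through_quotient B \<Gamma>3 G f \<longleftrightarrow> factors_through_quotient D \<Gamma>2 G (f \<circ> \<iota>)"
    "factors_through_quotient D \<Gamma>2 G (f \<circ> \<iota>) \<longleftrightarrow> (\<exists>s\<in>carrier G. f ` \<gamma> ` S_gens k = {s})"
    unfolding a b using ab bc ca by blast+
qed

lemma centre_embedding:
  obtains \<alpha> where "\<alpha> \<in> hom (D Mod \<Gamma>2) (B Mod \<Gamma>3)" "inj_on \<alpha> (carrier (D Mod \<Gamma>2))"
    "\<And>d. d \<in> carrier D \<Longrightarrow> \<alpha> (r d) = \<rho> (\<iota> d)"
    "\<alpha> ` carrier (D Mod \<Gamma>2) = centre (B Mod \<Gamma>3)"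
proof -
  have h: "\<rho> \<circ> \<iota> \<in> hom D (B Mod \<Gamma>3)" by (rule Group.hom_compose[OF \<iota>.homh \<rho>.homh])
  obtain \<alpha> where \<alpha>: "\<alpha> \<in> hom (D Mod \<Gamma>2) (B Mod \<Gamma>3)"
    "\<And>d. d \<in> carrier D \<Longrightarrow> \<alpha> (r d) = \<rho> (\<iota> d)"
    using N2.hom_factors[OF \<rho>.H.group_axioms h] \<rho>_\<iota>_trivial unfolding o_apply by blast
  interpret \<alpha>: group_hom "D Mod \<Gamma>2" "B Mod \<Gamma>3" \<alpha>
    by (simp add: group_hom_def group_hom_axioms_def \<alpha>(1) r.H.group_axioms \<rho>.H.group_axioms)
  show thesis
  proof (rule that[OF \<alpha>(1) _ \<alpha>(2)])
    have "q = \<one>\<^bsub>D Mod \<Gamma>2\<^esub>" if q: "q \<in> carrier (D Mod \<Gamma>2)" "\<alpha> q = \<one>\<^bsub>B Mod \<Gamma>3\<^esub>" for q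
    proof -
      obtain d where d: "d \<in> carrier D" "q = r d" using q(1) by (auto simp: carrier_FactGroup)
      then have "\<iota> d \<in> \<Gamma>3"
        using q(2) \<alpha>(2)[OF d(1)] N3.coset_eq_one_iff[OF \<iota>.hom_closed[OF d(1)]] by metis
      then show ?thesis
        using \<iota>_\<Gamma>3_imp_\<Gamma>2[OF d(1)] N2.coset_eq_one_iff[OF d(1)] d(2) by blast
    qed
    then show "inj_on \<alpha> (carrier (D Mod \<Gamma>2))"
      unfolding \<alpha>.inj_on_one_iff by blast
    show "\<alpha> ` carrier (D Mod \<Gamma>2) = centre (B Mod \<Gamma>3)"
      unfolding centre_eq carrier_FactGroup image_image using \<alpha>(2) by (intro image_cong) auto
  qed
qed

text \<open>A nontrivial element of the kernel is central, or has a nontrivial commutator, which is then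
  a nontrivial central element of the kernel.\<close>

lemma inj_on_if_inj_on_centre:
  assumes G: "group G" and h: "h \<in> hom (B Mod \<Gamma>3) G"
    and inj: "inj_on h (centre (B Mod \<Gamma>3))"
  shows "inj_on h (carrier (B Mod \<Gamma>3))"
proof -
  interpret h: group_hom "B Mod \<Gamma>3" G h
    by (simp add: group_hom_def group_hom_axioms_def h G \<rho>.H.group_axioms)
  have one: "\<one>\<^bsub>B Mod \<Gamma>3\<^esub> \<in> centre (B Mod \<Gamma>3)"
    using \<rho>_\<iota>_in_centre[OF D.one_closed] \<iota>.hom_one \<rho>.hom_one by metis
  have trivial: "z = \<one>\<^bsub>B Mod \<Gamma>3\<^esub>" if "z \<in> centre (B Mod \<Gamma>3)" "h z = \<one>\<^bsub>G\<^esub>" for z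
    using inj_onD[OF inj _ that(1) one] that(2) h.hom_one by metis
  have "p = \<one>\<^bsub>B Mod \<Gamma>3\<^esub>" if p: "p \<in> carrier (B Mod \<Gamma>3)" "h p = \<one>\<^bsub>G\<^esub>" for p
  proof (rule trivial[OF _ p(2)])
    show "p \<in> centre (B Mod \<Gamma>3)" unfolding centre_def
    proof (intro CollectI conjI ballI p(1))
      fix y assume y: "y \<in> carrier (B Mod \<Gamma>3)"
      let ?c = "p \<otimes>\<^bsub>B Mod \<Gamma>3\<^esub> y \<otimes>\<^bsub>B Mod \<Gamma>3\<^esub> inv\<^bsub>B Mod \<Gamma>3\<^esub> p \<otimes>\<^bsub>B Mod \<Gamma>3\<^esub> inv\<^bsub>B Mod \<Gamma>3\<^esub> y"
      obtain a where a: "a \<in> carrier B" "p = \<rho> a" using p(1) by (rule FactGroup_carrierE)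
      obtain b where b: "b \<in> carrier B" "y = \<rho> b" using y by (rule FactGroup_carrierE)
      have c: "?c = \<rho> (a \<otimes>\<^bsub>B\<^esub> b \<otimes>\<^bsub>B\<^esub> inv\<^bsub>B\<^esub> a \<otimes>\<^bsub>B\<^esub> inv\<^bsub>B\<^esub> b)"
        using a b by (simp del: mult_FactGroup)
      have "?c \<in> centre (B Mod \<Gamma>3)"
        unfolding centre_def
      proof (intro CollectI conjI ballI)
        show "?c \<in> carrier (B Mod \<Gamma>3)" using p y by (simp del: mult_FactGroup)
        fix z assume "z \<in> carrier (B Mod \<Gamma>3)"
        then obtain w where w: "w \<in> carrier B" "z = \<rho> w" by (rule FactGroup_carrierE)
        show "?c \<otimes>\<^bsub>B Mod \<Gamma>3\<^esub> z = z \<otimes>\<^bsub>B Mod \<Gamma>3\<^esub> ?c"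
          unfolding c w(2) by (rule \<rho>_commutator_central[OF a(1) b(1) w(1)])
      qed
      moreover have "h ?c = \<one>\<^bsub>G\<^esub>"
        using p y by (simp del: mult_FactGroup)
      ultimately have "?c = \<one>\<^bsub>B Mod \<Gamma>3\<^esub>" by (rule trivial)
      then show "p \<otimes>\<^bsub>B Mod \<Gamma>3\<^esub> y = y \<otimes>\<^bsub>B Mod \<Gamma>3\<^esub> p"
        using \<rho>.H.commute_iff_commutator[OF p(1) y] by blast
    qed
  qed
  then show ?thesis unfolding h.inj_on_one_iff by blast
qed

text \<open>One and the same \<alpha> has to serve for the embedding, the injectivity criterion and
  the extension, hence the single existential statement.\<close>

lemma centre_embedding_extends:
  assumes G: "group G" and f: "f \<in> hom B G"
  shows "\<exists>\<alpha>. \<alpha> \<in> hom (D Mod \<Gamma>2) (B Mod \<Gamma>3) \<and> inj_on \<alpha> (carrier (D Mod \<Gamma>2))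
    \<and> (\<forall>d\<in>carrier D. \<alpha> (r d) = \<rho> (\<iota> d))
    \<and> \<alpha> ` carrier (D Mod \<Gamma>2) = centre (B Mod \<Gamma>3)
    \<and> (\<forall>f3\<in>hom (B Mod \<Gamma>3) G.
         inj_on f3 (carrier (B Mod \<Gamma>3)) \<longleftrightarrow> inj_on (f3 \<circ> \<alpha>) (carrier (D Mod \<Gamma>2)))
    \<and> (\<forall>f2\<in>hom (D Mod \<Gamma>2) G.
         (\<forall>d\<in>carrier D. f (\<iota> d) = f2 (r d)) \<longrightarrow>
         (\<exists>f3\<in>hom (B Mod \<Gamma>3) G.
            (\<forall>b\<in>carrier B. f3 (\<rho> b) = f b)
            \<and> (\<forall>y\<in>carrier (D Mod \<Gamma>2). f2 y = f3 (\<alpha> y))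
            \<and> (inj_on f3 (carrier (B Mod \<Gamma>3)) \<longleftrightarrow> inj_on f2 (carrier (D Mod \<Gamma>2)))
            \<and> (inj_on f2 (carrier (D Mod \<Gamma>2)) \<and> f ` carrier B = carrier G \<longrightarrow>
                 f3 \<in> iso (B Mod \<Gamma>3) G)))"
proof -
  obtain \<alpha> where \<alpha>: "\<alpha> \<in> hom (D Mod \<Gamma>2) (B Mod \<Gamma>3)" "inj_on \<alpha> (carrier (D Mod \<Gamma>2))"
    "\<And>d. d \<in> carrier D \<Longrightarrow> \<alpha> (r d) = \<rho> (\<iota> d)"
    "\<alpha> ` carrier (D Mod \<Gamma>2) = centre (B Mod \<Gamma>3)"
    using centre_embedding by metis
  \<comment> \<open>As \<alpha> is a bijection onto the centre, injectivity of
    \<open>f3 \<circ> \<alpha>\<close> means injectivity of \<open>f3\<close> on the centre.\<close>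
  have inj_iff: "inj_on f3 (carrier (B Mod \<Gamma>3)) \<longleftrightarrow> inj_on (f3 \<circ> \<alpha>) (carrier (D Mod \<Gamma>2))"
    if f3: "f3 \<in> hom (B Mod \<Gamma>3) G" for f3
  proof
    have "centre (B Mod \<Gamma>3) \<subseteq> carrier (B Mod \<Gamma>3)" by (auto simp: centre_def)
    then show "inj_on f3 (carrier (B Mod \<Gamma>3)) \<Longrightarrow> inj_on (f3 \<circ> \<alpha>) (carrier (D Mod \<Gamma>2))"
      using \<alpha>(2,4) by (metis comp_inj_on inj_on_subset)
    assume "inj_on (f3 \<circ> \<alpha>) (carrier (D Mod \<Gamma>2))"
    then have "inj_on f3 (centre (B Mod \<Gamma>3))"
      using inj_on_imageI[of f3 \<alpha>] \<alpha>(4) by metis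
    then show "inj_on f3 (carrier (B Mod \<Gamma>3))" by (rule inj_on_if_inj_on_centre[OF G f3])
  qed
  have "\<exists>f3\<in>hom (B Mod \<Gamma>3) G.
      (\<forall>b\<in>carrier B. f3 (\<rho> b) = f b)
      \<and> (\<forall>y\<in>carrier (D Mod \<Gamma>2). f2 y = f3 (\<alpha> y))
      \<and> (inj_on f3 (carrier (B Mod \<Gamma>3)) \<longleftrightarrow> inj_on f2 (carrier (D Mod \<Gamma>2)))
      \<and> (inj_on f2 (carrier (D Mod \<Gamma>2)) \<and> f ` carrier B = carrier G \<longrightarrow> f3 \<in> iso (B Mod \<Gamma>3) G)"
    if f2: "f2 \<in> hom (D Mod \<Gamma>2) G" and compat: "\<forall>d\<in>carrier D. f (\<iota> d) = f2 (r d)" for f2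
  proof -
    have "factors_through_quotient D \<Gamma>2 G (f \<circ> \<iota>)"
      unfolding factors_through_quotient_def using f2 compat by auto
    then have "factors_through_quotient B \<Gamma>3 G f"
      by (simp only: factors_through_iff(1)[OF G f])
    then obtain f3 where f3: "f3 \<in> hom (B Mod \<Gamma>3) G" "\<forall>b\<in>carrier B. f b = f3 (\<rho> b)"
      unfolding factors_through_quotient_def by blast
    have eq: "f2 y = f3 (\<alpha> y)" if "y \<in> carrier (D Mod \<Gamma>2)" for y
      using that compat f3(2) \<alpha>(3) by (auto simp: carrier_FactGroup)
    then have "inj_on f2 (carrier (D Mod \<Gamma>2)) \<longleftrightarrow> inj_on (f3 \<circ> \<alpha>) (carrier (D Mod \<Gamma>2))"
      by (intro inj_on_cong) simp
    then have inj: "inj_on f3 (carrier (B Mod \<Gamma>3)) \<longleftrightarrow> inj_on f2 (carrier (D Mod \<Gamma>2))"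
      using inj_iff[OF f3(1)] by blast
    have "f3 ` carrier (B Mod \<Gamma>3) = f ` carrier B"
      unfolding carrier_FactGroup image_image using f3(2) by (intro image_cong) auto
    then have "f3 \<in> iso (B Mod \<Gamma>3) G"
      if "inj_on f2 (carrier (D Mod \<Gamma>2))" "f ` carrier B = carrier G"
      using that f3(1) inj by (simp add: iso_def bij_betw_def)
    then show ?thesis using f3 eq inj by (intro bexI[of _ f3]) auto
  qed
  note ext = this
  show ?thesis
    by (intro exI[of _ \<alpha>] conjI ballI impI; rule \<alpha> inj_iff ext; assumption)
qed

end

theorem corollary3p15:
  fixes k g n :: nat
    and X :: "'a topology" and P :: "'a set" and Q :: "complex set"
    and e :: "complex \<Rightarrow> 'a" and x :: "nat \<Rightarrow> complex"
    and \<gamma> :: "braid_gen \<Rightarrow> (real \<Rightarrow> (nat \<Rightarrow> 'a) set) set"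
    and \<delta> :: "braid_gen \<Rightarrow> (real \<Rightarrow> (nat \<Rightarrow> complex) set) set"
    and G :: "('c, 'm) monoid_scheme"
    and \<rho>G :: "(real \<Rightarrow> (nat \<Rightarrow> 'a) set) set \<Rightarrow> 'c"
  defines "B \<equiv> braid_group k (punctured X P) (compose {..<k} e x)"
    and "D \<equiv> braid_group k (punctured disc Q) x"
    and "\<iota> \<equiv> braid_map k (punctured X P) e x"
  defines "\<Gamma>3 \<equiv> lower_central B 3"
    and "\<Gamma>2 \<equiv> lower_central D 2"
  defines "\<rho>k \<equiv> (\<lambda>b. \<Gamma>3 #>\<^bsub>B\<^esub> b)"
    and "rk \<equiv> (\<lambda>d. \<Gamma>2 #>\<^bsub>D\<^esub> d)"
  assumes "k \<ge> 3" and "g \<ge> 1"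
    and "is_surface g X" and "P \<subseteq> surface_interior X" and "finite P" and "card P = n"
    and "embedding_map disc X e" and "Q \<subseteq> ball 0 1" and "e ` Q = P"
    and "x \<in> topspace (conf_space k (punctured disc Q))"
    and "has_presentation B \<gamma> (braid_gens k g n) (braid_rels k g n)"
    and "has_presentation D \<delta> (braid_gens k 0 n) (braid_rels k 0 n)"
    and "\<And>s. s \<in> braid_gens k 0 n \<Longrightarrow> \<iota> (\<delta> s) = \<gamma> s"
    and "group G" and "\<rho>G \<in> hom B G"
  shows
    "((factors_through_quotient B \<Gamma>3 G \<rho>G \<longleftrightarrow> factors_through_quotient D \<Gamma>2 G (\<rho>G \<circ> \<iota>))
      \<and> (factors_through_quotient D \<Gamma>2 G (\<rho>G \<circ> \<iota>) \<longleftrightarrow>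
           (\<exists>\<sigma>\<in>carrier G. \<rho>G ` \<gamma> ` S_gens k = {\<sigma>})))
     \<and> (\<exists>\<alpha>k.
          \<alpha>k \<in> hom (D Mod \<Gamma>2) (B Mod \<Gamma>3) \<and> inj_on \<alpha>k (carrier (D Mod \<Gamma>2))
          \<and> (\<forall>d\<in>carrier D. \<alpha>k (rk d) = \<rho>k (\<iota> d))
          \<and> \<alpha>k ` carrier (D Mod \<Gamma>2) = centre (B Mod \<Gamma>3)
          \<and> (\<forall>\<rho>G3\<in>hom (B Mod \<Gamma>3) G.
               inj_on \<rho>G3 (carrier (B Mod \<Gamma>3)) \<longleftrightarrow> inj_on (\<rho>G3 \<circ> \<alpha>k) (carrier (D Mod \<Gamma>2)))
          \<and> (\<forall>\<rho>G2\<in>hom (D Mod \<Gamma>2) G.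
               (\<forall>d\<in>carrier D. \<rho>G (\<iota> d) = \<rho>G2 (rk d)) \<longrightarrow>
               (\<exists>\<rho>G3\<in>hom (B Mod \<Gamma>3) G.
                  (\<forall>b\<in>carrier B. \<rho>G3 (\<rho>k b) = \<rho>G b)
                  \<and> (\<forall>y\<in>carrier (D Mod \<Gamma>2). \<rho>G2 y = \<rho>G3 (\<alpha>k y))
                  \<and> (inj_on \<rho>G3 (carrier (B Mod \<Gamma>3)) \<longleftrightarrow> inj_on \<rho>G2 (carrier (D Mod \<Gamma>2)))
                  \<and> (inj_on \<rho>G2 (carrier (D Mod \<Gamma>2)) \<and> \<rho>G ` carrier B = carrier G \<longrightarrow>
                       \<rho>G3 \<in> iso (B Mod \<Gamma>3) G))))"
proof -
  let ?x = "compose {..<k} e x"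
  have hom: "homeomorphic_map disc (subtopology X (e ` topspace disc)) e"
    using \<open>embedding_map disc X e\<close> by (simp add: embedding_map_def)
  have cont: "continuous_map disc X e"
    using homeomorphic_imp_continuous_map[OF hom] by (simp add: continuous_map_in_subtopology)
  have inj: "inj_on e (topspace disc)"
    using hom by (rule homeomorphic_imp_injective_map)
  have Q: "Q \<subseteq> topspace disc"
    using \<open>Q \<subseteq> ball 0 1\<close> by (auto simp: disc_def)
  have e: "continuous_map (punctured disc Q) (punctured X P) e"
    using continuous_map_punctured[OF cont inj Q] \<open>e ` Q = P\<close> by simp
  have inj': "inj_on e (topspace (punctured disc Q))"
    by (rule inj_on_subset[OF inj]) (auto simp: punctured_def)
  \<comment> \<open>The unit is the class of the constant loop, so the base configuration has to lie
    in the configuration space of the surface.\<close>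
  have "?x \<in> topspace (conf_space k (punctured X P))"
    using continuous_map_image_subset_topspace[OF continuous_map_compose_conf[OF e inj', of k]]
      \<open>x \<in> topspace (conf_space k (punctured disc Q))\<close> by blast
  then have B: "group B"
    unfolding B_def
    by (intro has_presentation_group[OF \<open>has_presentation B \<gamma> _ _\<close>[unfolded B_def]] braid_group_one)
  have D: "group D"
    unfolding D_def
    by (intro has_presentation_group[OF \<open>has_presentation D \<delta> _ _\<close>[unfolded D_def]] braid_group_one
        \<open>x \<in> topspace (conf_space k (punctured disc Q))\<close>)
  interpret pair: braid_pair B \<gamma> k g n D \<delta> \<iota>
  proof (intro braid_pair.intro presented.intro presented_axioms.intro group_hom.intro
      group_hom_axioms.intro braid_pair_axioms.intro B D assms)
    show "\<iota> \<in> hom D B" unfolding \<iota>_def D_def B_def using e inj' by (rule braid_map_hom)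
  qed
  show ?thesis
    unfolding \<rho>k_def rk_def \<Gamma>3_def \<Gamma>2_def
    using pair.factors_through_iff[OF \<open>group G\<close> \<open>\<rho>G \<in> hom B G\<close>]
      pair.centre_embedding_extends[OF \<open>group G\<close> \<open>\<rho>G \<in> hom B G\<close>] by blast
qed

end
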